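(* Let $G = SO_5(k)$, where $k$ is an algebraically closed field of characteristic not $2$, and let $B$ be a Borel subgroup of $G$, acting via the Adjoint action on the nilradical $\mathfrak{n}$ of its Lie algebra $\mathfrak{b}$ (with the realization, root vectors $x_\gamma\in\mathfrak{n}$ and coordinate functions $X_\gamma$ on $\mathfrak{n}$ for positive roots $\gamma$ fixed in the context). Then $B$ has exactly seven orbits on $\mathfrak{n}$, namely the orbits of the seven elements listed below; each orbit is the locally closed set given by the stated equations and has the stated dimension: (0) $B.0 = Z(X_{\alpha_1}, X_{\alpha_2}, X_{\alpha_1+\alpha_2}, X_{\alpha_1+2\alpha_2})$, of dimension $0$; (1) $B.x_{\alpha_1+2\alpha_2} = Z(X_{\alpha_1}, X_{\alpha_2}, X_{\alpha_1+\alpha_2}) \cap V(X_{\alpha_1+2\alpha_2})$, of dimension $1$; (2) $B.x_{\alpha_1+\alpha_2} = Z(X_{\alpha_1}, X_{\alpha_2}) \cap V(X_{\alpha_1+\alpha_2})$, of dimension $2$; (3) $B.x_{\alpha_1} = Z(X_{\alpha_2},\, X_{\alpha_1+\alpha_2}^2 + 2X_{\alpha_1}X_{\alpha_1+2\alpha_2}) \cap V(X_{\alpha_1})$, of dimension $2$; (4) $B.x_{\alpha_2} = Z(X_{\alpha_1}) \cap V(X_{\alpha_2})$, of dimension $3$; (5) $B.(x_{\alpha_1}+x_{\alpha_1+2\alpha_2}) = Z(X_{\alpha_2}) \cap V(X_{\alpha_1}) \cap V(X_{\alpha_1+\alpha_2}^2 + 2X_{\alpha_1}X_{\alpha_1+2\alpha_2})$,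 of dimension $3$; (6) $B.(x_{\alpha_1}+x_{\alpha_2}) = V(X_{\alpha_1}) \cap V(X_{\alpha_2})$, of dimension $4$. Moreover, the closure order $\preceq$ on the set of these seven orbits is the partial order whose covering relations (the edges of its Hasse diagram, with $\prec$ meaning "is covered by") are exactly: $$B.0 \prec B.x_{\alpha_1+2\alpha_2};$$ $$B.x_{\alpha_1+2\alpha_2} \prec B.x_{\alpha_1+\alpha_2}, \qquad B.x_{\alpha_1+2\alpha_2} \prec B.x_{\alpha_1};$$ $$B.x_{\alpha_1+\alpha_2} \prec B.x_{\alpha_2}, \qquad B.x_{\alpha_1+\alpha_2} \prec B.(x_{\alpha_1}+x_{\alpha_1+2\alpha_2}), \qquad B.x_{\alpha_1} \prec B.(x_{\alpha_1}+x_{\alpha_1+2\alpha_2});$$ $$B.x_{\alpha_2} \prec B.(x_{\alpha_1}+x_{\alpha_2}), \qquad B.(x_{\alpha_1}+x_{\alpha_1+2\alpha_2}) \prec B.(x_{\alpha_1}+x_{\alpha_2}).$$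
   Context: Realization. $SO_5(k)$ is the group of $5\times 5$ matrices $g$ over $k$ with $\det g = 1$ and $g^{\mathsf T} J g = J$, where $J = e_{11}+e_{24}+e_{42}+e_{35}+e_{53}$ and $e_{ij}$ is the matrix with $1$ in position $(i,j)$ and $0$ elsewhere. Its Lie algebra is $\mathfrak{g}=\mathfrak{so}_5(k)=\{x : x^{\mathsf T}J+Jx=0\}$, and the Adjoint action of $G$ on $\mathfrak{g}$ is conjugation of matrices, $g.x = gxg^{-1}$. The maximal torus $T$ consists of the diagonal matrices $T(s,t)=\mathrm{diag}(1,s,t,s^{-1},t^{-1})$ with $s,t\in k\setminus\{0\}$. The root system is of type $B_2$, with simple roots $\alpha_1,\alpha_2$ given by $\alpha_1(T(s,t))=s t^{-1}$ and $\alpha_2(T(s,t))=t$, and positive roots $\Phi^+=\{\alpha_1,\ \alpha_2,\ \alpha_1+\alpha_2,\ \alpha_1+2\alpha_2\}$. All Borel subgroups of $G$ are conjugate; $B=TU$ denotes the Borel subgroup containing $T$ determined by $\Phi^+$, where the unipotent radical $U$ is generated by the root groups $U_\gamma$, $\gamma\in\Phi^+$. The Lie algebra $\mathfrak{b}$ of $B$ has nilradical $\mathfrak{n}=\mathrm{Lie}(U)$, which is the $k$-span of the root vectors $$x_{\alpha_1}=e_{23}-e_{54},\quad x_{\alpha_2}=e_{15}-e_{31},\quad x_{\alpha_1+\alpha_2}=e_{14}-e_{21},\quad x_{\alpha_1+2\alpha_2}=e_{25}-e_{34}.$$ Thus $\mathfrak{n}\cong k^4$ as an affine variety, and $B$ acts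 on $\mathfrak{n}$ by conjugation. For $\gamma\in\Phi^+$, $X_\gamma:\mathfrak{n}\to k$ is the coordinate function giving the coefficient of $x_\gamma$: for $x=a_1x_{\alpha_1}+a_2x_{\alpha_2}+a_3x_{\alpha_1+\alpha_2}+a_4x_{\alpha_1+2\alpha_2}$, one has $X_{\alpha_1}(x)=a_1$, $X_{\alpha_2}(x)=a_2$, $X_{\alpha_1+\alpha_2}(x)=a_3$, $X_{\alpha_1+2\alpha_2}(x)=a_4$. Notation. For polynomials $f,f_1,\dots,f_m$ in these four coordinate functions, $Z(f_1,\dots,f_m)\subseteq\mathfrak{n}$ is the set of common zeros of the $f_i$, and $V(f)=\mathfrak{n}\setminus Z(f)$ is the set of points where $f$ is nonzero (note that $V$ denotes the non-vanishing set). $B.x$ denotes the $B$-orbit of $x$. The closure order on orbits is defined by $B.x\preceq B.y$ if and only if $B.x\subseteq\overline{B.y}$ (Zariski closure in $\mathfrak{n}$). Dimension means dimension as an algebraic variety. *)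

theory Defs
  imports
    "HOL-Analysis.Analysis"
    "HOL-Algebra.Generated_Groups"
    "HOL-Algebra.Group_Action"
    "HOL-Computational_Algebra.Polynomial"
begin

(* Rows and columns are indexed by the type 5, in which the numeral 5 is the same element as 0;
   the five elements are 1, 2, 3, 4, 5. *)

definition munit :: "5 \<Rightarrow> 5 \<Rightarrow> 'a::field^5^5" where
  "munit i j = (\<chi> a b. if a = i \<and> b = j then 1 else 0)"

definition formJ :: "'a::field^5^5" where
  "formJ = munit 1 1 + munit 2 4 + munit 4 2 + munit 3 5 + munit 5 3"

definition SO5 :: "('a::field^5^5) monoid" where
  "SO5 = \<lparr> carrier = {g. det g = 1 \<and> transpose g ** formJ ** g = formJ},
           mult = (**), one = mat 1 \<rparr>"

definition Ad :: "'a::field^5^5 \<Rightarrow> 'a^5^5 \<Rightarrow> 'a^5^5" where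
  "Ad g x = g ** x ** matrix_inv g"

definition torus_elt :: "'a::field \<Rightarrow> 'a \<Rightarrow> 'a^5^5" where
  "torus_elt s t = (\<chi> i j. if i = j then vector [1, s, t, inverse s, inverse t] $ i else 0)"

definition torus :: "('a::field^5^5) set" where
  "torus = {torus_elt s t | s t. s \<noteq> 0 \<and> t \<noteq> 0}"

datatype pos_root = Alpha1 | Alpha2 | Alpha1_Alpha2 | Alpha1_2Alpha2

lemma UNIV_pos_root: "UNIV = {Alpha1, Alpha2, Alpha1_Alpha2, Alpha1_2Alpha2}"
  using pos_root.exhaust by auto

instance pos_root :: finite
  by standard (simp add: UNIV_pos_root)

(* root_char r s t is the value of the root r, as a character of the torus, at torus_elt s t.
   Addition of roots is multiplication of characters. *)
fun root_char :: "pos_root \<Rightarrow> 'a::field \<Rightarrow> 'a \<Rightarrow> 'a" where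
  "root_char Alpha1 s t = s * inverse t"
| "root_char Alpha2 s t = t"
| "root_char Alpha1_Alpha2 s t = (s * inverse t) * t"
| "root_char Alpha1_2Alpha2 s t = (s * inverse t) * t^2"

(* u is an injective homomorphism of algebraic groups from the additive group of the field to SO5
   on whose image the torus acts through the root r. *)
definition root_hom :: "pos_root \<Rightarrow> ('a::field \<Rightarrow> 'a^5^5) \<Rightarrow> bool" where
  "root_hom r u \<longleftrightarrow>
     (\<forall>c. u c \<in> carrier SO5) \<and>
     (\<forall>i j. \<exists>p. \<forall>c. u c $ i $ j = poly p c) \<and>
     (\<forall>c d. u (c + d) = u c ** u d) \<and>
     inj u \<and>
     (\<forall>s t c. s \<noteq> 0 \<longrightarrow> t \<noteq> 0 \<longrightarrow>
        torus_elt s t ** u c ** matrix_inv (torus_elt s t) = u (root_char r s t * c))"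

(* Over an algebraically closed field of characteristic other than 2, a homomorphism u as above
   is unique up to rescaling its argument, so the union below is
   the image of any one of them. *)
definition root_group :: "pos_root \<Rightarrow> ('a::field^5^5) set" where
  "root_group r = (\<Union>u \<in> {u. root_hom r u}. range u)"

definition unipotent_radical :: "('a::field^5^5) set" where
  "unipotent_radical = generate SO5 (\<Union>r. root_group r)"

definition borel_SO5 :: "('a::field^5^5) monoid" where
  "borel_SO5 = SO5 \<lparr> carrier := torus <#>\<^bsub>SO5\<^esub> unipotent_radical \<rparr>"

fun root_vec :: "pos_root \<Rightarrow> 'a::field^5^5" where
  "root_vec Alpha1 = munit 2 3 - munit 5 4"
| "root_vec Alpha2 = munit 1 5 - munit 3 1"
| "root_vec Alpha1_Alpha2 = munit 1 4 - munit 2 1"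
| "root_vec Alpha1_2Alpha2 = munit 2 5 - munit 3 4"

(* mat c ** x is the scalar multiple of the matrix x by c. *)
definition lincomb :: "(pos_root \<Rightarrow> 'a::field) \<Rightarrow> 'a^5^5" where
  "lincomb a = (\<Sum>r\<in>UNIV. mat (a r) ** root_vec r)"

definition nilrad :: "('a::field^5^5) set" where
  "nilrad = range lincomb"

definition X :: "pos_root \<Rightarrow> 'a::field^5^5 \<Rightarrow> 'a" where
  "X r x = inv_into UNIV lincomb x r"

lemma mat_mult_component: "(mat c ** x) $ i $ j = (c::'a::field) * (x :: 'a^5^5) $ i $ j"
proof -
  have "(mat c ** x) $ i $ j = (\<Sum>k\<in>UNIV. if i = k then c * x $ k $ j else 0)"
    by (simp add: matrix_matrix_mult_def mat_def if_distrib[of "\<lambda>z. z * _"] cong: if_cong)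
  then show ?thesis by simp
qed

lemma lincomb_components:
  fixes a :: "pos_root \<Rightarrow> 'a::field"
  shows "lincomb a $ 2 $ 3 = a Alpha1" "lincomb a $ 1 $ 5 = a Alpha2"
    "lincomb a $ 1 $ 4 = a Alpha1_Alpha2" "lincomb a $ 2 $ 5 = a Alpha1_2Alpha2"
  unfolding lincomb_def UNIV_pos_root
  by (simp_all add: mat_mult_component munit_def)

lemma inj_lincomb: "inj (lincomb :: (pos_root \<Rightarrow> 'a::field) \<Rightarrow> _)"
proof (rule injI)
  fix a b :: "pos_root \<Rightarrow> 'a" assume "lincomb a = lincomb b"
  then have "a r = b r" for r
    using lincomb_components[of a] lincomb_components[of b] by (cases r) auto
  then show "a = b" by blast
qed

lemma X_lincomb: "X r (lincomb a) = a r"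
  by (simp add: X_def inv_into_f_f[OF inj_lincomb])

(* Polynomials in the coordinate functions, as functions; zero sets depend on nothing else. *)
inductive_set poly_fun :: "('a::field^5^5 \<Rightarrow> 'a) set" where
  const: "(\<lambda>_. c) \<in> poly_fun"
| coord: "X r \<in> poly_fun"
| add: "f \<in> poly_fun \<Longrightarrow> g \<in> poly_fun \<Longrightarrow> (\<lambda>x. f x + g x) \<in> poly_fun"
| mult: "f \<in> poly_fun \<Longrightarrow> g \<in> poly_fun \<Longrightarrow> (\<lambda>x. f x * g x) \<in> poly_fun"

definition Z :: "('a::field^5^5 \<Rightarrow> 'a) set \<Rightarrow> ('a^5^5) set" where
  "Z F = {x \<in> nilrad. \<forall>f\<in>F. f x = 0}"

definition V :: "('a::field^5^5 \<Rightarrow> 'a) \<Rightarrow> ('a^5^5) set" where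
  "V f = nilrad - Z {f}"

definition zariski :: "('a::field^5^5) topology" where
  "zariski = topology (\<lambda>S. \<exists>F \<subseteq> poly_fun. S = nilrad - Z F)"

lemma istopology_zariski:
  "istopology (\<lambda>S. \<exists>F \<subseteq> poly_fun. S = nilrad - Z (F :: ('a::field^5^5 \<Rightarrow> 'a) set))"
  unfolding istopology_def
proof (intro conjI allI impI)
  fix S T :: "('a^5^5) set"
  assume "\<exists>F\<subseteq>poly_fun. S = nilrad - Z F" and "\<exists>F\<subseteq>poly_fun. T = nilrad - Z F"
  then obtain F G where F: "F \<subseteq> poly_fun" "S = nilrad - Z F"
    and G: "G \<subseteq> poly_fun" "T = nilrad - Z G" by blast
  let ?H = "{\<lambda>x. f x * g x | f g. f \<in> F \<and> g \<in> G}"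
  have "S \<inter> T = nilrad - Z ?H"
    unfolding F(2) G(2) Z_def by (auto; metis mult_eq_0_iff)
  moreover have "?H \<subseteq> poly_fun" using F(1) G(1) by (auto intro: poly_fun.mult)
  ultimately show "\<exists>F\<subseteq>poly_fun. S \<inter> T = nilrad - Z F" by blast
next
  fix \<K> :: "('a^5^5) set set"
  assume "\<forall>K\<in>\<K>. \<exists>F\<subseteq>poly_fun. K = nilrad - Z F"
  then obtain F where F: "\<And>K. K \<in> \<K> \<Longrightarrow> F K \<subseteq> poly_fun \<and> K = nilrad - Z (F K)" by metis
  have "\<Union>\<K> = (\<Union>K\<in>\<K>. nilrad - Z (F K))" using F by (metis (no_types, lifting) SUP_cong SUP_identity_eq)
  also have "\<dots> = nilrad - Z (\<Union>K\<in>\<K>. F K)" by (auto simp: Z_def)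
  finally show "\<exists>F\<subseteq>poly_fun. \<Union>\<K> = nilrad - Z F" using F by (metis (no_types, lifting) UN_least)
qed

lemma openin_zariski: "openin zariski S \<longleftrightarrow> (\<exists>F \<subseteq> poly_fun. S = nilrad - Z F)"
  unfolding zariski_def by (simp add: topology_inverse'[OF istopology_zariski])

lemma topspace_zariski: "topspace zariski = (nilrad :: ('a::field^5^5) set)"
proof -
  have "openin zariski (nilrad :: ('a^5^5) set)"
    unfolding openin_zariski
    by (rule exI[of _ "{\<lambda>_. 1}"]) (auto simp: Z_def intro: poly_fun.const)
  moreover have "openin zariski S \<Longrightarrow> S \<subseteq> nilrad" for S :: "('a^5^5) set"
    unfolding openin_zariski by blast
  ultimately show ?thesis unfolding topspace_def by blast
qed

lemma closedin_zariski: "closedin zariski S \<longleftrightarrow> (\<exists>F \<subseteq> poly_fun. S = Z F)"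
proof -
  have "Z F \<subseteq> nilrad" for F :: "('a^5^5 \<Rightarrow> 'a) set" by (auto simp: Z_def)
  then show ?thesis
    unfolding closedin_def topspace_zariski openin_zariski by (metis double_diff subset_refl)
qed

definition irreducible_in :: "'b topology \<Rightarrow> 'b set \<Rightarrow> bool" where
  "irreducible_in T S \<longleftrightarrow> S \<subseteq> topspace T \<and> S \<noteq> {} \<and>
     (\<forall>C D. closedin T C \<longrightarrow> closedin T D \<longrightarrow> S \<subseteq> C \<union> D \<longrightarrow> S \<subseteq> C \<or> S \<subseteq> D)"

definition krull_dim :: "'b topology \<Rightarrow> enat" where
  "krull_dim T = Sup {enat n | n. \<exists>C :: nat \<Rightarrow> 'b set.
     (\<forall>i\<le>n. closedin T (C i) \<and> irreducible_in T (C i)) \<and> (\<forall>i<n. C i \<subset> C (Suc i))}"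

definition variety_dim :: "('a::field^5^5) set \<Rightarrow> enat" where
  "variety_dim S = krull_dim (subtopology zariski S)"

definition closure_order :: "('a::field^5^5) set set \<Rightarrow> (('a^5^5) set \<times> ('a^5^5) set) set" where
  "closure_order \<O> = {(P, Q). P \<in> \<O> \<and> Q \<in> \<O> \<and> P \<subseteq> zariski closure_of Q}"

definition covering :: "('b \<times> 'b) set \<Rightarrow> ('b \<times> 'b) set" where
  "covering r = {(x, y) \<in> r. x \<noteq> y \<and> \<not> (\<exists>z. z \<noteq> x \<and> z \<noteq> y \<and> (x, z) \<in> r \<and> (z, y) \<in> r)}"

end

theory Submission
  imports Defs
begin

text \<open>
  The nilradical is a four-dimensional space on which the Borel subgroup is triangular, so the
  orbits can be found by hand. In the coordinates \<open>(a, b, c, d)\<close> along the root vectors for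
  \<open>\<alpha>\<^sub>1, \<alpha>\<^sub>2, \<alpha>\<^sub>1 + \<alpha>\<^sub>2, \<alpha>\<^sub>1 + 2\<alpha>\<^sub>2\<close> the torus scales each coordinate by the root, and an element
  of the unipotent radical fixes \<open>a\<close> and \<open>b\<close>, adds multiples of \<open>a\<close> and \<open>b\<close> to \<open>c\<close>, and adds a
  combination of \<open>a, b, c\<close> to \<open>d\<close> (lemmas \<open>Ad_torus_elt\<close>, \<open>Ad_unip\<close>). Hence the vanishing of \<open>a\<close>
  and of \<open>b\<close> is invariant; on \<open>b = 0\<close> the form \<open>c\<^sup>2 + 2ad\<close> is invariant up to squares; where
  \<open>a = b = 0\<close> so is the vanishing of \<open>c\<close>, and then that of \<open>d\<close>. This gives the seven strata.
  Conversely, each stratum is swept out from its representative by one torus element followed by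
  at most two root group elements (\<open>orbit_of_rep\<close>).

  The unipotent radical is generated by the images of all homomorphisms on which the torus acts
  by a positive root. The strata are invariant under these because all of the images are
  unitriangular for one ordering of the five basis vectors: restrict the equivariance to a
  one-parameter subgroup of the torus on which every positive root is a positive power and
  compare the polynomial entries of both sides (\<open>root_hom_unitriangular\<close>). A unitriangular
  isometry is determined by four of its entries (\<open>unitriangular_isometry_eq_unip\<close>), which makes
  the action explicit.

  For the topology, every closure in question is a linear coordinate subspace, or the quadric
  cone \<open>b = 0, c\<^sup>2 + 2ad = 0\<close>, which is the image of a plane under a quadratic map because
  square roots exist. In all cases any two points of the closure are joined by a polynomial
  curve in the closure, and a curve that meets the stratum lies in it except for finitely many
  parameters. As the field is infinite, such curves prove both irreducibility and the
  description of the closures (\<open>joined_irreducible\<close>, \<open>closure_of_stratum\<close>); the closure order is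
  then read off from the equations.

  The lower bounds for the dimensions come from explicit flags of coordinate slices. For the
  upper bounds, a strict chain of irreducible closed sets yields polynomial functions, each
  vanishing on one member of the chain but not on the next, and these are algebraically
  independent (\<open>independent_on_Cons\<close>). Counting monomials shows that there are at most four
  algebraically independent functions on a space with four coordinates
  (\<open>independent_on_length_le_4\<close>). A chain inside a small stratum is prolonged upwards by
  coordinate subspaces, so that the bound four for the whole space bounds the dimension of each
  stratum (\<open>tower_in_coordinate_subspace\<close>).
\<close>

section \<open>Algebraically closed fields\<close>

text \<open>
  Over a finite field, adding \<open>1\<close> to the product of all \<open>X - a\<close> gives a polynomial without a
  root.
\<close>

lemma infinite_alg_closed_field: "infinite (UNIV :: 'a::alg_closed_field set)"
proof
  assume fin: "finite (UNIV :: 'a set)"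
  define p :: "'a poly" where "p = (\<Prod>a\<in>UNIV. [:- a, 1:])"
  have root: "poly p z = 0" for z
    unfolding p_def poly_prod using fin by (subst prod_zero_iff) auto
  have "degree p = card (UNIV :: 'a set)"
    unfolding p_def by (subst degree_prod_eq_sum_degree) auto
  then have "degree p > 0" using fin by (simp add: finite_UNIV_card_ge_0)
  then have "degree (p + 1) > 0" by (simp add: degree_add_eq_left)
  then obtain z where "poly (p + 1) z = 0" using alg_closed_imp_poly_has_root by blast
  then show False using root by simp
qed

lemma poly_eq_0_cofinite:
  fixes p :: "'a::alg_closed_field poly"
  assumes "finite {z. poly p z \<noteq> 0}"
  shows "p = 0"
proof (rule ccontr)
  assume "p \<noteq> 0"
  then have "finite {z. poly p z = 0}" by (rule poly_roots_finite)
  then have "finite ({z. poly p z = 0} \<union> {z. poly p z \<noteq> 0})" using assms by simp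
  moreover have "{z. poly p z = 0} \<union> {z. poly p z \<noteq> 0} = UNIV" by auto
  ultimately show False using infinite_alg_closed_field[where 'a='a] by simp
qed

lemma two_neq_0:
  assumes "CHAR('a::field) \<noteq> 2"
  shows "(2 :: 'a) \<noteq> 0"
proof
  assume "(2 :: 'a) = 0"
  then have "of_nat 2 = (0 :: 'a)" by simp
  then have "CHAR('a) dvd 2" by (simp only: of_nat_eq_0_iff_char_dvd)
  then have "CHAR('a) = 1 \<or> CHAR('a) = 2" using two_is_prime_nat prime_nat_iff by blast
  then show False using assms CHAR_not_1[where 'a='a] by simp
qed

section \<open>The special orthogonal group\<close>

lemma exhaust_5:
  fixes x :: 5
  shows "x = 1 \<or> x = 2 \<or> x = 3 \<or> x = 4 \<or> x = 5"
proof (induct x)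
  case (of_int z)
  then have "0 \<le> z" and "z < 5" by simp_all
  then have "z = 0 \<or> z = 1 \<or> z = 2 \<or> z = 3 \<or> z = 4" by arith
  then show ?case by auto
qed

lemma forall_5: "(\<forall>i::5. P i) \<longleftrightarrow> P 1 \<and> P 2 \<and> P 3 \<and> P 4 \<and> P 5"
  by (metis exhaust_5)

lemma UNIV_5: "UNIV = {1, 2, 3, 4, 5 :: 5}"
  using exhaust_5 by auto

lemma sum_5: "sum f (UNIV :: 5 set) = f 1 + f 2 + f 3 + f 4 + f 5"
  unfolding UNIV_5 by (simp add: ac_simps)

lemma matrix_mult_5:
  fixes A B :: "'a::semiring_1^5^5"
  shows "(A ** B) $ i $ j =
    A$i$1 * B$1$j + A$i$2 * B$2$j + A$i$3 * B$3$j + A$i$4 * B$4$j + A$i$5 * B$5$j"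
  by (simp add: matrix_matrix_mult_def sum_5)

lemma matrix_eq_entries:
  fixes A B :: "'a^'n^'m"
  shows "A = B \<longleftrightarrow> (\<forall>i j. A $ i $ j = B $ i $ j)"
  by (simp add: vec_eq_iff)

lemma formJ_entries:
  "(formJ :: 'a::field^5^5) $ i $ j =
    (if (i, j) \<in> {(1, 1), (2, 4), (4, 2), (3, 5), (5, 3)} then 1 else 0)"
  using exhaust_5[of i] exhaust_5[of j]
  by (elim disjE) (simp_all add: formJ_def munit_def)

lemma transpose_formJ [simp]: "transpose formJ = (formJ :: 'a::field^5^5)"
  by (simp add: matrix_eq_entries transpose_def formJ_entries forall_5)

lemma formJ_square [simp]: "formJ ** formJ = (mat 1 :: 'a::field^5^5)"
  by (simp add: matrix_eq_entries forall_5 matrix_mult_5 formJ_entries mat_def)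

text \<open>
  The adjoint of \<open>g\<close> with respect to the bilinear form \<open>formJ\<close>. Since \<open>formJ\<close> is its own
  inverse, \<open>g\<close> preserves the form exactly if \<open>adjoint_J g\<close> is its inverse; so inverses in \<open>SO5\<close>
  permute the entries, and conjugation needs no division.
\<close>

definition adjoint_J :: "'a::field^5^5 \<Rightarrow> 'a^5^5" where
  "adjoint_J g = formJ ** transpose g ** formJ"

lemma adjoint_J_mult: "adjoint_J (g ** h) = adjoint_J h ** adjoint_J g"
proof -
  have "adjoint_J h ** adjoint_J g
      = formJ ** transpose h ** (formJ ** formJ) ** transpose g ** formJ"
    unfolding adjoint_J_def by (simp only: matrix_mul_assoc)
  then show ?thesis
    unfolding adjoint_J_def matrix_transpose_mul by (simp add: matrix_mul_assoc)
qed

lemma adjoint_J_involution [simp]: "adjoint_J (adjoint_J g) = g"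
proof -
  have "adjoint_J (adjoint_J g) = (formJ ** formJ) ** g ** (formJ ** formJ)"
    unfolding adjoint_J_def matrix_transpose_mul transpose_formJ transpose_transpose
    by (simp only: matrix_mul_assoc)
  then show ?thesis by simp
qed

text \<open>
  Multiplication by \<open>formJ\<close> exchanges the indices \<open>2, 4\<close> and \<open>3, 5\<close>, which are paired by the
  form.
\<close>

lemma adjoint_J_entries:
  "adjoint_J g $ i $ j =
    g $ (if j = 1 then 1 else if j = 2 then 4 else if j = 4 then 2 else if j = 3 then 5 else 3)
      $ (if i = 1 then 1 else if i = 2 then 4 else if i = 4 then 2 else if i = 3 then 5 else 3)"
  using exhaust_5[of i] exhaust_5[of j]
  by (elim disjE) (simp_all add: adjoint_J_def matrix_mult_5 formJ_entries transpose_def)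

lemma isometry_iff:
  "transpose g ** formJ ** g = formJ \<longleftrightarrow> adjoint_J g ** g = mat 1"
proof
  assume "transpose g ** formJ ** g = formJ"
  then have "formJ ** (transpose g ** formJ ** g) = mat 1" by simp
  then show "adjoint_J g ** g = mat 1"
    unfolding adjoint_J_def by (simp only: matrix_mul_assoc)
next
  assume "adjoint_J g ** g = mat 1"
  then have "formJ ** (adjoint_J g ** g) = formJ" by simp
  moreover have "formJ ** (adjoint_J g ** g) = (formJ ** formJ) ** transpose g ** formJ ** g"
    unfolding adjoint_J_def by (simp only: matrix_mul_assoc)
  ultimately show "transpose g ** formJ ** g = formJ" by simp
qed

lemma carrier_SO5: "g \<in> carrier SO5 \<longleftrightarrow> det g = 1 \<and> adjoint_J g ** g = mat 1"
  by (simp add: SO5_def isometry_iff)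

lemma det_adjoint_J: "det (adjoint_J g) = det g"
proof -
  have "det (formJ ** formJ :: 'a^5^5) = 1" by simp
  then have "det (formJ :: 'a^5^5) * det (formJ :: 'a^5^5) = 1" by (simp only: det_mul)
  then show ?thesis by (simp add: adjoint_J_def det_mul ac_simps)
qed

lemma SO5_adjoint_J:
  assumes "g \<in> carrier SO5"
  shows "adjoint_J g ** g = mat 1" "g ** adjoint_J g = mat 1" "adjoint_J g \<in> carrier SO5"
proof -
  show 1: "adjoint_J g ** g = mat 1" using assms by (simp add: carrier_SO5)
  then show 2: "g ** adjoint_J g = mat 1" using matrix_left_right_inverse by blast
  show "adjoint_J g \<in> carrier SO5"
    using assms 2 by (simp add: carrier_SO5 det_adjoint_J)
qed

lemma SO5_mult: "x \<otimes>\<^bsub>SO5\<^esub> y = x ** y" and SO5_one: "\<one>\<^bsub>SO5\<^esub> = mat 1"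
  by (simp_all add: SO5_def)

lemma group_SO5: "group (SO5 :: ('a::field^5^5) monoid)"
proof (rule groupI)
  fix x y :: "'a^5^5" assume x: "x \<in> carrier SO5" and y: "y \<in> carrier SO5"
  have "adjoint_J (x ** y) ** (x ** y) = adjoint_J y ** (adjoint_J x ** x) ** y"
    by (simp add: adjoint_J_mult matrix_mul_assoc)
  then show "x \<otimes>\<^bsub>SO5\<^esub> y \<in> carrier SO5"
    using x y by (simp add: carrier_SO5 SO5_mult det_mul)
next
  show "\<one>\<^bsub>SO5\<^esub> \<in> carrier (SO5 :: ('a^5^5) monoid)"
    by (simp add: SO5_def transpose_mat)
next
  fix x :: "'a^5^5" assume "x \<in> carrier SO5"
  then show "\<exists>y\<in>carrier SO5. y \<otimes>\<^bsub>SO5\<^esub> x = \<one>\<^bsub>SO5\<^esub>"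
    using SO5_adjoint_J by (auto simp: SO5_mult SO5_one)
qed (auto simp: SO5_mult SO5_one matrix_mul_assoc)

lemma inv_SO5:
  assumes "g \<in> carrier SO5"
  shows "inv\<^bsub>SO5\<^esub> g = adjoint_J g"
proof -
  interpret group "SO5 :: ('a^5^5) monoid" by (rule group_SO5)
  show ?thesis
    using SO5_adjoint_J[OF assms] assms by (intro inv_equality) (auto simp: SO5_mult SO5_one)
qed

lemma matrix_inv_SO5:
  assumes "g \<in> carrier SO5"
  shows "matrix_inv g = adjoint_J g"
proof -
  have "\<exists>h. g ** h = mat 1 \<and> h ** g = mat 1" using SO5_adjoint_J[OF assms] by blast
  then have "g ** matrix_inv g = mat 1" unfolding matrix_inv_def by (rule someI2_ex) simp
  then have "adjoint_J g ** (g ** matrix_inv g) = adjoint_J g" by simp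
  then show ?thesis using SO5_adjoint_J(1)[OF assms] by (simp add: matrix_mul_assoc)
qed

lemma Ad_SO5: "g \<in> carrier SO5 \<Longrightarrow> Ad g x = g ** x ** adjoint_J g"
  by (simp add: Ad_def matrix_inv_SO5)

lemma Ad_mult:
  assumes "g \<in> carrier SO5" "h \<in> carrier SO5"
  shows "Ad (g ** h) x = Ad g (Ad h x)"
proof -
  interpret group "SO5 :: ('a^5^5) monoid" by (rule group_SO5)
  have "g ** h \<in> carrier SO5" using m_closed[OF assms] by (simp add: SO5_mult)
  then show ?thesis using assms by (simp add: Ad_SO5 adjoint_J_mult matrix_mul_assoc)
qed

lemma Ad_mat_1 [simp]: "Ad (mat 1) x = x"
proof -
  interpret group "SO5 :: ('a^5^5) monoid" by (rule group_SO5)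
  have "mat 1 \<in> carrier (SO5 :: ('a^5^5) monoid)" using one_closed by (simp add: SO5_one)
  then show ?thesis by (simp add: Ad_SO5 adjoint_J_def transpose_mat)
qed

section \<open>The torus\<close>

lemma torus_elt_entries:
  "torus_elt s t $ i $ j = (if i = j then if i = 1 then 1 else if i = 2 then s else if i = 3 then t
     else if i = 4 then inverse s else inverse t else 0)"
  using exhaust_5[of i]
  by (elim disjE) (simp_all add: torus_elt_def vector_def)

lemma prod_5: "prod f (UNIV :: 5 set) = f 1 * f 2 * f 3 * f 4 * f 5"
  unfolding UNIV_5 by (simp add: ac_simps)

lemma det_torus_elt:
  fixes s t :: "'a::field"
  assumes "s \<noteq> 0" "t \<noteq> 0"
  shows "det (torus_elt s t) = 1"
proof -
  have "det (torus_elt s t) = (\<Prod>i\<in>UNIV. torus_elt s t $ i $ i)"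
    by (rule det_diagonal) (simp add: torus_elt_def)
  then show ?thesis using assms by (simp add: prod_5 torus_elt_entries field_simps)
qed

lemma torus_elt_in_SO5:
  fixes s t :: "'a::field"
  assumes "s \<noteq> 0" "t \<noteq> 0"
  shows "torus_elt s t \<in> carrier SO5"
  using assms by (simp add: carrier_SO5 det_torus_elt)
    (simp add: matrix_eq_entries forall_5 matrix_mult_5 adjoint_J_entries torus_elt_entries mat_def)

lemma torus_elt_mult: "torus_elt s t ** torus_elt s' t' = torus_elt (s * s') (t * t')"
  by (simp add: matrix_eq_entries forall_5 matrix_mult_5 torus_elt_entries)

lemma adjoint_J_torus_elt: "adjoint_J (torus_elt s t) = torus_elt (inverse s) (inverse t)"
  by (simp add: matrix_eq_entries forall_5 adjoint_J_entries torus_elt_entries)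

section \<open>The unipotent radical\<close>

text \<open>
  The diagonal entry of \<open>torus_elt (z\<^sup>2) z\<close> in row \<open>i\<close> is \<open>z powi diag_weight i\<close>. This
  one-parameter subgroup is regular: the five weights are distinct and every positive root
  restricts to a positive power of \<open>z\<close>. So the weights order the basis as \<open>2, 3, 1, 5, 4\<close>, and
  the root groups become unitriangular with respect to this order.
\<close>

definition diag_weight :: "5 \<Rightarrow> int" where
  "diag_weight i =
    (if i = 2 then 2 else if i = 3 then 1 else if i = 1 then 0 else if i = 5 then -1 else -2)"

lemma diag_weight_simps [simp]:
  "diag_weight 1 = 0" "diag_weight 2 = 2" "diag_weight 3 = 1" "diag_weight 4 = -2" "diag_weight 5 = -1"
  by (simp_all add: diag_weight_def)

lemma diag_weight_inject: "diag_weight i = diag_weight j \<longleftrightarrow> i = j"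
  using exhaust_5[of i] exhaust_5[of j] by (elim disjE) simp_all

definition unitriangular :: "'a::field^5^5 \<Rightarrow> bool" where
  "unitriangular g \<longleftrightarrow> (\<forall>i j. diag_weight i \<le> diag_weight j \<longrightarrow> g $ i $ j = (if i = j then 1 else 0))"

lemma unitriangular_mult: "unitriangular g \<Longrightarrow> unitriangular h \<Longrightarrow> unitriangular (g ** h)"
  by (simp add: unitriangular_def forall_5 matrix_mult_5)

lemma unitriangular_adjoint_J: "unitriangular g \<Longrightarrow> unitriangular (adjoint_J g)"
  by (simp add: unitriangular_def forall_5 adjoint_J_entries)

lemma subgroup_unitriangular:
  "subgroup {g \<in> carrier SO5. unitriangular g} (SO5 :: ('a::field^5^5) monoid)"
proof -
  interpret group "SO5 :: ('a^5^5) monoid" by (rule group_SO5)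
  show ?thesis
  proof (rule subgroup.intro)
    show "\<one>\<^bsub>SO5\<^esub> \<in> {g \<in> carrier (SO5 :: ('a^5^5) monoid). unitriangular g}"
      using one_closed by (simp add: SO5_one unitriangular_def mat_def)
  next
    fix x y :: "'a^5^5"
    assume "x \<in> {g \<in> carrier SO5. unitriangular g}"
      and "y \<in> {g \<in> carrier SO5. unitriangular g}"
    then show "x \<otimes>\<^bsub>SO5\<^esub> y \<in> {g \<in> carrier SO5. unitriangular g}"
      using m_closed by (simp add: unitriangular_mult SO5_mult)
  next
    fix x :: "'a^5^5" assume "x \<in> {g \<in> carrier SO5. unitriangular g}"
    then show "inv\<^bsub>SO5\<^esub> x \<in> {g \<in> carrier SO5. unitriangular g}"
      using SO5_adjoint_J(3)[of x] by (simp add: inv_SO5 unitriangular_adjoint_J)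
  qed blast
qed

text \<open>
  The unitriangular isometry with prescribed entries at the positions
  \<open>(2,3), (1,5), (1,4), (2,5)\<close> that carry the four root vectors. The remaining entries are
  forced by the form.
\<close>

definition unip :: "'a::field \<Rightarrow> 'a \<Rightarrow> 'a \<Rightarrow> 'a \<Rightarrow> 'a^5^5" where
  "unip p q r s = (\<chi> i j.
     if i = j then 1
     else if (i, j) = (2, 3) then p
     else if (i, j) = (1, 5) then q
     else if (i, j) = (1, 4) then r
     else if (i, j) = (2, 5) then s
     else if (i, j) = (5, 4) then - p
     else if (i, j) = (3, 1) then - q
     else if (i, j) = (2, 1) then - r - p * q
     else if (i, j) = (3, 5) then - (q^2 / 2)
     else if (i, j) = (3, 4) then - s - p * (q^2 / 2) - q * r
     else if (i, j) = (2, 4) then - (r^2 / 2) - p * s - p^2 * (q^2 / 2) - p * q * r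
     else 0)"

text \<open>
  Each product of two columns under the form gives one equation. The equations for the column
  pairs \<open>(1,5), (5,5), (3,4), (1,4), (5,4), (4,4)\<close> can be solved in this order for one new entry
  each; the products of a column with itself contain that entry twice, so that \<open>2\<close> has to be
  inverted.
\<close>

lemma unitriangular_isometry_eq_unip:
  fixes g :: "'a::field^5^5"
  assumes two: "(2 :: 'a) \<noteq> 0" and tri: "unitriangular g" and iso: "adjoint_J g ** g = mat 1"
  shows "g = unip (g$2$3) (g$1$5) (g$1$4) (g$2$5)"
proof -
  have z: "g$1$1 = 1" "g$2$2 = 1" "g$3$3 = 1" "g$4$4 = 1" "g$5$5 = 1"
    "g$1$2 = 0" "g$1$3 = 0" "g$3$2 = 0" "g$5$1 = 0" "g$5$2 = 0" "g$5$3 = 0"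
    "g$4$1 = 0" "g$4$2 = 0" "g$4$3 = 0" "g$4$5 = 0"
    using tri by (simp_all add: unitriangular_def)
  have e: "(adjoint_J g ** g) $ i $ j = mat 1 $ i $ j" for i j using iso by simp
  have "g$1$5 + g$3$1 = 0"
    using e[of 1 5] z by (simp add: matrix_mult_5 adjoint_J_entries mat_def add.commute)
  then have g31: "g$3$1 = - g$1$5" by (simp add: eq_neg_iff_add_eq_0 add.commute)
  have "g$1$5 * g$1$5 + (g$3$5 + g$3$5) = 0"
    using e[of 3 5] z by (simp add: matrix_mult_5 adjoint_J_entries mat_def add_ac)
  then have "g$3$5 * 2 = - (g$1$5 * g$1$5)"
    by (simp only: eq_neg_iff_add_eq_0 mult_2_right add_ac)
  then have g35: "g$3$5 = - ((g$1$5)^2 / 2)"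
    by (simp only: minus_divide_left nonzero_eq_divide_eq[OF two] power2_eq_square)
  have "g$2$3 + g$5$4 = 0"
    using e[of 5 4] z by (simp add: matrix_mult_5 adjoint_J_entries mat_def add.commute)
  then have g54: "g$5$4 = - g$2$3" by (simp add: eq_neg_iff_add_eq_0 add.commute)
  have "g$2$1 + g$1$4 + g$3$1 * g$5$4 = 0"
    using e[of 1 4] z by (simp add: matrix_mult_5 adjoint_J_entries mat_def add_ac mult.commute)
  then have "g$2$1 + (g$1$4 + g$2$3 * g$1$5) = 0" by (simp add: g31 g54 add_ac mult.commute)
  then have g21: "g$2$1 = - g$1$4 - g$2$3 * g$1$5"
    by (simp only: eq_neg_iff_add_eq_0[symmetric]) simp
  have "g$2$5 + g$3$5 * g$5$4 + g$1$5 * g$1$4 + g$3$4 = 0"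
    using e[of 3 4] z by (simp add: matrix_mult_5 adjoint_J_entries mat_def add_ac mult.commute)
  then have "g$3$4 + (g$2$5 + g$2$3 * ((g$1$5)^2 / 2) + g$1$5 * g$1$4) = 0"
    by (simp add: g35 g54 add_ac mult.commute)
  then have g34: "g$3$4 = - g$2$5 - g$2$3 * ((g$1$5)^2 / 2) - g$1$5 * g$1$4"
    by (simp only: eq_neg_iff_add_eq_0[symmetric]) simp
  have "g$1$4 * g$1$4 + (g$2$4 + g$2$4) + (g$3$4 * g$5$4 + g$3$4 * g$5$4) = 0"
    using e[of 2 4] z by (simp add: matrix_mult_5 adjoint_J_entries mat_def add_ac mult.commute)
  then have "(g$2$4 + g$3$4 * g$5$4) * 2 + g$1$4 * g$1$4 = 0"
    by (simp only: mult_2_right add_ac)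
  then have "g$2$4 + g$3$4 * g$5$4 = - ((g$1$4)^2 / 2)"
    by (simp only: minus_divide_left nonzero_eq_divide_eq[OF two] power2_eq_square eq_neg_iff_add_eq_0)
  then have "g$2$4 = - ((g$1$4)^2 / 2) - g$3$4 * g$5$4" by (simp add: eq_diff_eq)
  then have g24: "g$2$4 = - ((g$1$4)^2 / 2) - g$2$3 * g$2$5
      - (g$2$3)^2 * ((g$1$5)^2 / 2) - g$2$3 * g$1$5 * g$1$4"
    by (simp add: g34 g54 algebra_simps power2_eq_square)
  show ?thesis
    by (simp add: matrix_eq_entries forall_5 unip_def z g31 g35 g54 g21 g34 g24)
qed

fun root_unip :: "pos_root \<Rightarrow> 'a::field \<Rightarrow> 'a^5^5" where
  "root_unip Alpha1 c = unip c 0 0 0"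
| "root_unip Alpha2 c = unip 0 c 0 0"
| "root_unip Alpha1_Alpha2 c = unip 0 0 c 0"
| "root_unip Alpha1_2Alpha2 c = unip 0 0 0 c"

lemma four_neq_0: "(2 :: 'a::field) \<noteq> 0 \<Longrightarrow> (4 :: 'a) \<noteq> 0"
  using mult_eq_0_iff[of "2 :: 'a" 2] by simp

lemma root_unip_add:
  assumes two: "(2 :: 'a::field) \<noteq> 0"
  shows "root_unip r (c + d :: 'a) = root_unip r c ** root_unip r d"
  using two four_neq_0[OF two] by (cases r; simp add: matrix_eq_entries forall_5 matrix_mult_5 unip_def;
    simp add: field_simps power2_eq_square)

text \<open>
  The determinant of an isometry is \<open>1\<close> or \<open>-1\<close>. Here it is also a square, because the element
  with parameter \<open>c\<close> is the square of the one with parameter \<open>c / 2\<close>.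
\<close>

lemma root_unip_in_SO5:
  assumes two: "(2 :: 'a::field) \<noteq> 0"
  shows "root_unip r (c :: 'a) \<in> carrier SO5"
proof -
  have "adjoint_J (root_unip r d) = root_unip r (- d)" for d :: 'a
    by (cases r) (simp_all add: matrix_eq_entries forall_5 adjoint_J_entries unip_def)
  moreover have "root_unip r (0 :: 'a) = mat 1"
    by (cases r) (simp_all add: matrix_eq_entries unip_def mat_def)
  ultimately have iso: "adjoint_J (root_unip r d) ** root_unip r d = mat 1" for d :: 'a
    using root_unip_add[OF two, of r "- d" d] by simp
  have "det (adjoint_J (root_unip r d) ** root_unip r d) = 1" for d :: 'a
    by (simp add: iso)
  then have "det (root_unip r d) * det (root_unip r d) = 1" for d :: 'a
    by (simp add: det_mul det_adjoint_J)
  moreover have "c / 2 + c / 2 = c" using two by (simp add: field_simps)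
  ultimately have "det (root_unip r c) = 1"
    using root_unip_add[OF two, of r "c / 2" "c / 2"] by (simp add: det_mul)
  then show ?thesis using iso by (simp add: carrier_SO5)
qed

lemma matrix_inv_torus_elt:
  "s \<noteq> 0 \<Longrightarrow> t \<noteq> 0 \<Longrightarrow> matrix_inv (torus_elt s t) = torus_elt (inverse s) (inverse t)"
  by (simp add: matrix_inv_SO5 torus_elt_in_SO5 adjoint_J_torus_elt)

lemma torus_conj_entries:
  assumes "s \<noteq> 0" "t \<noteq> 0"
  shows "(torus_elt s t ** g ** matrix_inv (torus_elt s t)) $ i $ j
    = torus_elt s t $ i $ i * g $ i $ j * inverse (torus_elt s t $ j $ j)"
  using exhaust_5[of i] exhaust_5[of j]
  by (elim disjE) (simp_all add: matrix_inv_torus_elt assms matrix_mult_5 torus_elt_entries)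

lemma root_unip_conj:
  assumes "s \<noteq> 0" "t \<noteq> 0"
  shows "torus_elt s t ** root_unip r c ** matrix_inv (torus_elt s t)
    = root_unip r (root_char r s t * c)"
  unfolding vec_eq_iff torus_conj_entries[OF assms]
  using assms by (cases r; simp add: forall_5 torus_elt_entries unip_def;
    simp add: field_simps power2_eq_square)

lemma root_unip_poly: "\<exists>p. \<forall>c. root_unip r c $ i $ j = poly p (c :: 'a::field)"
proof -
  define polynomial where "polynomial f \<longleftrightarrow> (\<exists>p. \<forall>c. f c = poly p c)" for f :: "'a \<Rightarrow> 'a"
  have If: "polynomial (\<lambda>c. if b then f c else g c)" if "polynomial f" "polynomial g" for b f g
    using that by (cases b) simp_all
  have const: "polynomial (\<lambda>_. a)" for a
    unfolding polynomial_def by (rule exI[of _ "[:a:]"]) simp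
  have id: "polynomial (\<lambda>c. c)"
    unfolding polynomial_def by (rule exI[of _ "[:0, 1:]"]) simp
  have uminus: "polynomial (\<lambda>c. - c)"
    unfolding polynomial_def by (rule exI[of _ "[:0, -1:]"]) simp
  have square: "polynomial (\<lambda>c. - (c^2 / 2))"
    unfolding polynomial_def by (rule exI[of _ "[:0, 0, - (1 / 2):]"]) (simp add: power2_eq_square)
  have "polynomial (\<lambda>c. root_unip r c $ i $ j)"
    by (cases r; simp add: unip_def cong: if_cong; intro If const id uminus square)
  then show ?thesis by (simp add: polynomial_def)
qed

lemma root_hom_root_unip:
  assumes two: "(2 :: 'a::field) \<noteq> 0"
  shows "root_hom r (root_unip r :: 'a \<Rightarrow> _)"
  unfolding root_hom_def
proof (intro conjI allI impI)
  have "root_unip r c = root_unip r d \<Longrightarrow> c = d" for c d :: 'a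
    by (cases r) (simp_all add: matrix_eq_entries forall_5 unip_def)
  then show "inj (root_unip r :: 'a \<Rightarrow> _)" by (auto intro: injI)
qed (use two in \<open>simp_all add: root_unip_in_SO5 root_unip_poly root_unip_add root_unip_conj\<close>)

lemma root_hom_0:
  assumes "root_hom r u"
  shows "u 0 = mat 1"
proof -
  have "u 0 \<in> carrier SO5" "u (0 + 0) = u 0 ** u 0" using assms by (simp_all only: root_hom_def)
  then have "adjoint_J (u 0) ** u 0 = adjoint_J (u 0) ** u 0 ** u 0"
    by (metis add_0 matrix_mul_assoc)
  then show ?thesis using \<open>u 0 \<in> carrier SO5\<close> by (simp add: carrier_SO5)
qed

fun root_height :: "pos_root \<Rightarrow> nat" where
  "root_height Alpha1 = 1"
| "root_height Alpha2 = 1"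
| "root_height Alpha1_Alpha2 = 2"
| "root_height Alpha1_2Alpha2 = 3"

lemma torus_elt_cocharacter: "torus_elt (z^2) z $ i $ i = z powi diag_weight i"
  using exhaust_5[of i]
  by (elim disjE) (simp_all add: torus_elt_entries power_int_def power_inverse)

lemma root_char_cocharacter: "z \<noteq> 0 \<Longrightarrow> root_char r (z^2) z = z ^ root_height r"
  by (cases r) (simp_all add: power2_eq_square power3_eq_cube)

text \<open>
  Let \<open>i\<close> have at most the weight of \<open>j\<close>. Conjugating by \<open>torus_elt (z\<^sup>2) z\<close> multiplies the
  \<open>(i, j)\<close> entry by a power \<open>z\<^sup>-\<^sup>m\<close> with \<open>m \<ge> 0\<close>, while by equivariance it replaces the argument
  \<open>c\<close> by \<open>z\<^sup>h c\<close> with \<open>h > 0\<close>. So the entry \<open>p\<close> satisfies \<open>p(c) = z\<^sup>m p(z\<^sup>h c)\<close> for all nonzero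
  \<open>z\<close>. This is an identity of polynomials in \<open>z\<close>, and at \<open>z = 0\<close> it says that the entry is that
  of the identity matrix.
\<close>

lemma root_hom_unitriangular:
  fixes u :: "'a::alg_closed_field \<Rightarrow> 'a^5^5"
  assumes u: "root_hom r u"
  shows "unitriangular (u c)"
  unfolding unitriangular_def
proof (intro allI impI)
  fix i j assume le: "diag_weight i \<le> diag_weight j"
  define m where "m = nat (diag_weight j - diag_weight i)"
  obtain p where p: "\<And>c. u c $ i $ j = poly p c" using u unfolding root_hom_def by blast
  have eq: "poly p c = z ^ m * poly p (z ^ root_height r * c)" if z: "z \<noteq> 0" for z
  proof -
    have "u (z ^ root_height r * c) = torus_elt (z^2) z ** u c ** matrix_inv (torus_elt (z^2) z)"
      using u z by (simp add: root_hom_def root_char_cocharacter)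
    then have "poly p (z ^ root_height r * c)
        = z powi diag_weight i * poly p c * inverse (z powi diag_weight j)"
      using z by (simp add: torus_conj_entries torus_elt_cocharacter flip: p)
    moreover have "z powi diag_weight j = z ^ m * z powi diag_weight i"
      using le z by (simp add: m_def power_int_add[symmetric] flip: power_int_of_nat)
    ultimately show ?thesis using z by (simp add: field_simps)
  qed
  \<comment> \<open>The factor \<open>z\<close> makes the identity hold at \<open>z = 0\<close> as well; it is cancelled afterwards.\<close>
  define q where "q = [:0, 1:] * (monom 1 m * pcompose p (monom c (root_height r)) - [:poly p c:])"
  have "poly q z = 0" for z
    using eq[of z] by (cases "z = 0") (simp_all add: q_def poly_monom poly_pcompose mult.commute)
  then have "q = 0" by (intro poly_eq_0_cofinite) simp
  then have "poly (monom 1 m * pcompose p (monom c (root_height r)) - [:poly p c:]) 0 = 0"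
    by (simp add: q_def)
  then have "poly p c = 0 ^ m * poly p 0"
    by (cases r) (simp_all add: poly_monom poly_pcompose)
  moreover have "poly p 0 = mat 1 $ i $ j" using root_hom_0[OF u] p[of 0] by simp
  moreover have "m = 0 \<longleftrightarrow> i = j" using le diag_weight_inject[of i j] by (auto simp: m_def)
  ultimately show "u c $ i $ j = (if i = j then 1 else 0)"
    using p by (simp add: mat_def power_0_left)
qed

lemma root_group_in_SO5: "root_group r \<subseteq> carrier SO5"
  by (auto simp: root_group_def root_hom_def)

lemma unipotent_radical_subgroup: "subgroup unipotent_radical (SO5 :: ('a::field^5^5) monoid)"
proof -
  interpret group "SO5 :: ('a^5^5) monoid" by (rule group_SO5)
  show ?thesis unfolding unipotent_radical_def
    using root_group_in_SO5 by (intro generate_is_subgroup) blast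
qed

lemma unipotent_radical_unitriangular:
  "unipotent_radical \<subseteq> {g \<in> carrier (SO5 :: ('a::alg_closed_field^5^5) monoid). unitriangular g}"
proof -
  interpret group "SO5 :: ('a^5^5) monoid" by (rule group_SO5)
  show ?thesis unfolding unipotent_radical_def
  proof (rule generate_subgroup_incl[OF _ subgroup_unitriangular])
    show "(\<Union>r. root_group r) \<subseteq> {g \<in> carrier (SO5 :: ('a^5^5) monoid). unitriangular g}"
      using root_group_in_SO5 root_hom_unitriangular by (fastforce simp: root_group_def)
  qed
qed

lemma root_unip_in_unipotent_radical:
  assumes "(2 :: 'a::field) \<noteq> 0"
  shows "root_unip r (c :: 'a) \<in> unipotent_radical"
  unfolding unipotent_radical_def
  using root_hom_root_unip[OF assms, of r]
  by (intro generate.incl) (auto simp: root_group_def)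

text \<open>
  By equivariance, conjugation by a torus element maps each root group into itself.
\<close>

lemma torus_normalizes_unipotent_radical:
  fixes s t :: "'a::field"
  assumes st: "s \<noteq> 0" "t \<noteq> 0" and "g \<in> unipotent_radical"
  shows "torus_elt s t ** g ** adjoint_J (torus_elt s t) \<in> unipotent_radical"
proof -
  interpret group "SO5 :: ('a^5^5) monoid" by (rule group_SO5)
  let ?t = "torus_elt s t"
  note t = torus_elt_in_SO5[OF st]
  have conj: "?t ** g ** adjoint_J ?t \<in> root_group r" if g: "g \<in> root_group r" for g r
  proof -
    obtain u c where u: "root_hom r u" "g = u c" using g by (auto simp: root_group_def)
    then have "?t ** g ** matrix_inv ?t = u (root_char r s t * c)"
      using st by (simp add: root_hom_def)
    then show ?thesis using u by (auto simp: matrix_inv_SO5[OF t] root_group_def)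
  qed
  show ?thesis using assms(3) unfolding unipotent_radical_def
  proof (induction rule: generate.induct)
    case one
    then show ?case using generate.one[of SO5] by (simp add: SO5_one SO5_adjoint_J[OF t])
  next
    case (incl g)
    then show ?case using conj by (intro generate.incl) blast
  next
    case (inv g)
    then have g: "g \<in> carrier SO5" using root_group_in_SO5 by blast
    have "?t ** g ** adjoint_J ?t \<in> (\<Union>r. root_group r)" using inv conj by blast
    moreover from this have "inv\<^bsub>SO5\<^esub> (?t ** g ** adjoint_J ?t) = ?t ** inv\<^bsub>SO5\<^esub> g ** adjoint_J ?t"
      using root_group_in_SO5 by (subst inv_SO5) (auto simp: inv_SO5 g adjoint_J_mult matrix_mul_assoc)
    ultimately show ?case using generate.inv by metis
  next
    case (eng g h)
    have "?t ** (g ** h) ** adjoint_J ?t = ?t ** g ** (adjoint_J ?t ** ?t) ** h ** adjoint_J ?t"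
      by (simp add: SO5_adjoint_J[OF t] matrix_mul_assoc)
    then show ?case using generate.eng[OF eng.IH] by (simp add: SO5_mult matrix_mul_assoc)
  qed
qed

section \<open>The Borel subgroup\<close>

lemma carrier_borel_SO5:
  "carrier borel_SO5 = {torus_elt s t ** u | s t u. s \<noteq> 0 \<and> t \<noteq> 0 \<and> u \<in> unipotent_radical}"
  by (auto simp: borel_SO5_def set_mult_def torus_def SO5_mult)

text \<open>
  The product of a group with a group that it normalizes is a group.
\<close>

lemma borel_SO5_subgroup: "subgroup (carrier borel_SO5) (SO5 :: ('a::field^5^5) monoid)"
proof -
  interpret group "SO5 :: ('a^5^5) monoid" by (rule group_SO5)
  interpret U: subgroup unipotent_radical "SO5 :: ('a^5^5) monoid" by (rule unipotent_radical_subgroup)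
  show ?thesis
  proof (rule subgroup.intro)
    show "carrier borel_SO5 \<subseteq> carrier (SO5 :: ('a^5^5) monoid)"
      using m_closed[OF torus_elt_in_SO5 U.mem_carrier] by (auto simp: carrier_borel_SO5 SO5_mult)
  next
    have "torus_elt 1 1 = (mat 1 :: 'a^5^5)"
      by (simp add: matrix_eq_entries torus_elt_entries mat_def)
    then show "\<one>\<^bsub>SO5\<^esub> \<in> carrier (borel_SO5 :: ('a^5^5) monoid)"
      using U.one_closed unfolding carrier_borel_SO5 SO5_one
      by (intro CollectI exI[of _ 1] exI[of _ "mat 1"]) simp
  next
    fix x y :: "'a^5^5" assume "x \<in> carrier borel_SO5" "y \<in> carrier borel_SO5"
    then obtain s t u s' t' u' where
      x: "x = torus_elt s t ** u" "s \<noteq> 0" "t \<noteq> 0" "u \<in> unipotent_radical" and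
      y: "y = torus_elt s' t' ** u'" "s' \<noteq> 0" "t' \<noteq> 0" "u' \<in> unipotent_radical"
      by (auto simp: carrier_borel_SO5)
    let ?T = "torus_elt s' t'"
    note T = SO5_adjoint_J[OF torus_elt_in_SO5[OF y(2,3)]]
    have "adjoint_J ?T ** u ** ?T \<in> unipotent_radical"
      using torus_normalizes_unipotent_radical[of "inverse s'" "inverse t'" u] x y
      by (simp flip: adjoint_J_torus_elt)
    then have "(adjoint_J ?T ** u ** ?T) ** u' \<in> unipotent_radical"
      using U.m_closed y(4) by (simp add: SO5_mult)
    moreover have "x ** y = torus_elt s t ** (?T ** adjoint_J ?T) ** u ** ?T ** u'"
      unfolding T x(1) y(1) by (simp add: matrix_mul_assoc)
    then have "x ** y = torus_elt (s * s') (t * t') ** ((adjoint_J ?T ** u ** ?T) ** u')"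
      by (simp add: matrix_mul_assoc flip: torus_elt_mult)
    ultimately show "x \<otimes>\<^bsub>SO5\<^esub> y \<in> carrier borel_SO5"
      unfolding SO5_mult carrier_borel_SO5 using x y
      by (intro CollectI exI[of _ "s * s'"] exI[of _ "t * t'"]
          exI[of _ "(adjoint_J ?T ** u ** ?T) ** u'"]) simp
  next
    fix x :: "'a^5^5" assume "x \<in> carrier borel_SO5"
    then obtain s t u where
      x: "x = torus_elt s t ** u" "s \<noteq> 0" "t \<noteq> 0" "u \<in> unipotent_radical"
      by (auto simp: carrier_borel_SO5)
    let ?T = "torus_elt s t"
    note T = SO5_adjoint_J[OF torus_elt_in_SO5[OF x(2,3)]]
    have u: "u \<in> carrier SO5" using x(4) U.subset by blast
    then have "adjoint_J u \<in> unipotent_radical" using U.m_inv_closed[OF x(4)] by (simp add: inv_SO5)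
    then have "?T ** adjoint_J u ** adjoint_J ?T \<in> unipotent_radical"
      using torus_normalizes_unipotent_radical[OF x(2,3)] by blast
    moreover have "x \<in> carrier SO5"
      using m_closed[OF torus_elt_in_SO5[OF x(2,3)] u] by (simp add: x(1) SO5_mult)
    then have "inv\<^bsub>SO5\<^esub> x = (adjoint_J ?T ** ?T) ** adjoint_J u ** adjoint_J ?T"
      unfolding T by (simp add: inv_SO5 x(1) adjoint_J_mult)
    then have "inv\<^bsub>SO5\<^esub> x = torus_elt (inverse s) (inverse t) ** (?T ** adjoint_J u ** adjoint_J ?T)"
      by (simp add: matrix_mul_assoc adjoint_J_torus_elt)
    ultimately show "inv\<^bsub>SO5\<^esub> x \<in> carrier borel_SO5"
      unfolding carrier_borel_SO5 using x
      by (intro CollectI exI[of _ "inverse s"] exI[of _ "inverse t"]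
          exI[of _ "?T ** adjoint_J u ** adjoint_J ?T"]) simp
  qed
qed

section \<open>Polynomial curves in the nilradical\<close>

text \<open>
  Along such a curve every polynomial function on the nilradical is a polynomial in the parameter,
  so that it vanishes identically or for only finitely many parameters.
\<close>

definition curve :: "(pos_root \<Rightarrow> 'a::field poly) \<Rightarrow> 'a \<Rightarrow> 'a^5^5" where
  "curve P z = lincomb (\<lambda>r. poly (P r) z)"

lemma poly_fun_curve:
  assumes "f \<in> poly_fun"
  shows "\<exists>q. \<forall>z. f (curve P z) = poly q z"
  using assms
proof induction
  case (const c)
  show ?case by (rule exI[of _ "[:c:]"]) simp
next
  case (coord r)
  show ?case by (rule exI[of _ "P r"]) (simp add: curve_def X_lincomb)
next
  case (add f g)
  then obtain p q where "\<forall>z. f (curve P z) = poly p z" "\<forall>z. g (curve P z) = poly q z" by blast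
  then show ?case by (intro exI[of _ "p + q"]) simp
next
  case (mult f g)
  then obtain p q where "\<forall>z. f (curve P z) = poly p z" "\<forall>z. g (curve P z) = poly q z" by blast
  then show ?case by (intro exI[of _ "p * q"]) simp
qed

lemma curve_in_nilrad: "curve P z \<in> nilrad"
  by (simp add: curve_def nilrad_def)

text \<open>
  A polynomial function that vanishes on the set vanishes at almost all, hence at all, points of
  the curve.
\<close>

lemma closure_of_curve:
  fixes P :: "pos_root \<Rightarrow> 'a::alg_closed_field poly"
  assumes "finite {z. curve P z \<notin> S}"
  shows "curve P w \<in> zariski closure_of S"
  unfolding in_closure_of topspace_zariski
proof (intro conjI allI impI)
  fix T assume "curve P w \<in> T \<and> openin zariski T"
  then obtain F where F: "F \<subseteq> poly_fun" "T = nilrad - Z F" and w: "curve P w \<in> T"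
    by (auto simp: openin_zariski)
  then obtain f where f: "f \<in> F" "f (curve P w) \<noteq> 0" by (auto simp: Z_def)
  then obtain q where q: "\<And>z. f (curve P z) = poly q z" using poly_fun_curve F(1) by blast
  have "\<not> {z. poly q z \<noteq> 0} \<subseteq> {z. curve P z \<notin> S}"
    using f(2) q poly_eq_0_cofinite[of q] finite_subset[OF _ assms] by auto
  then obtain z where "poly q z \<noteq> 0" "curve P z \<in> S" by blast
  moreover from this have "curve P z \<notin> Z F" using f(1) q[of z] by (force simp: Z_def)
  ultimately show "\<exists>y. y \<in> S \<and> y \<in> T" using F(2) curve_in_nilrad by blast
qed (rule curve_in_nilrad)

text \<open>
  Let two closed sets cover \<open>S\<close> and let each of them miss a point of \<open>S\<close>. Along a curve that
  joins the two points, equations that witness this restrict to nonzero polynomials whose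
  product vanishes at almost all parameters, which is impossible.
\<close>

lemma irreducible_in_zariskiI:
  fixes S :: "('a::alg_closed_field^5^5) set"
  assumes "S \<subseteq> nilrad" "S \<noteq> {}"
    and join: "\<And>p q. p \<in> S \<Longrightarrow> q \<in> S \<Longrightarrow>
      \<exists>P. curve P 0 = p \<and> curve P 1 = q \<and> finite {z. curve P z \<notin> S}"
  shows "irreducible_in zariski S"
  unfolding irreducible_in_def topspace_zariski
proof (intro conjI allI impI)
  fix C D assume "closedin zariski C" "closedin zariski D" and sub: "S \<subseteq> C \<union> D"
  then obtain F G where F: "F \<subseteq> poly_fun" "C = Z F" and G: "G \<subseteq> poly_fun" "D = Z G"
    by (auto simp: closedin_zariski)
  show "S \<subseteq> C \<or> S \<subseteq> D"
  proof (rule ccontr)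
    assume "\<not> (S \<subseteq> C \<or> S \<subseteq> D)"
    then obtain p q where pq: "p \<in> S" "p \<notin> C" "q \<in> S" "q \<notin> D" by blast
    then obtain f g where f: "f \<in> F" "f p \<noteq> 0" and g: "g \<in> G" "g q \<noteq> 0"
      using F(2) G(2) assms(1) by (auto simp: Z_def)
    obtain P where P: "curve P 0 = p" "curve P 1 = q" "finite {z. curve P z \<notin> S}"
      using join pq by blast
    obtain u v where u: "\<And>z. f (curve P z) = poly u z" and v: "\<And>z. g (curve P z) = poly v z"
      using poly_fun_curve[of f P] poly_fun_curve[of g P] f(1) g(1) F(1) G(1) by blast
    have "f x * g x = 0" if "x \<in> S" for x
      using sub that F(2) G(2) f(1) g(1) by (auto simp: Z_def)
    then have "{z. poly (u * v) z \<noteq> 0} \<subseteq> {z. curve P z \<notin> S}"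
      by (auto simp flip: u v)
    then have "u * v = 0" using P(3) poly_eq_0_cofinite finite_subset by blast
    then have "u = 0 \<or> v = 0" by simp
    then show False using f(2) g(2) P(1,2) u v by fastforce
  qed
qed (use assms in auto)

lemma irreducible_in_subtopology:
  "irreducible_in (subtopology T S) C \<longleftrightarrow> C \<subseteq> S \<and> irreducible_in T C"
proof (cases "C \<subseteq> S")
  case True
  have 1: "C \<subseteq> D \<inter> S \<longleftrightarrow> C \<subseteq> D" for D using True by blast
  have 2: "C \<subseteq> (D \<inter> S) \<union> (E \<inter> S) \<longleftrightarrow> C \<subseteq> D \<union> E" for D E using True by blast
  have "irreducible_in (subtopology T S) C \<longleftrightarrow> C \<subseteq> topspace T \<and> C \<noteq> {} \<and>
      (\<forall>D E. closedin T D \<longrightarrow> closedin T E \<longrightarrow> C \<subseteq> (D \<inter> S) \<union> (E \<inter> S) \<longrightarrow>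
        C \<subseteq> D \<inter> S \<or> C \<subseteq> E \<inter> S)"
    unfolding irreducible_in_def closedin_subtopology topspace_subtopology using True by blast
  then show ?thesis unfolding irreducible_in_def 1 2 using True by simp
next
  case False
  then show ?thesis by (auto simp: irreducible_in_def)
qed

text \<open>
  The functions on an irreducible set have no zero divisors.
\<close>

lemma irreducible_in_zariski_mult:
  assumes "irreducible_in zariski D" "f \<in> poly_fun" "g \<in> poly_fun" "\<forall>x\<in>D. f x * g x = 0"
    and "\<exists>x\<in>D. f x \<noteq> 0"
  shows "\<forall>x\<in>D. g x = 0"
proof -
  have sub: "D \<subseteq> nilrad" using assms(1) by (simp add: irreducible_in_def topspace_zariski)
  have "closedin zariski (Z {f})" "closedin zariski (Z {g})"
    using assms(2,3) by (auto simp: closedin_zariski)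
  moreover have "D \<subseteq> Z {f} \<union> Z {g}" using sub assms(4) by (auto simp: Z_def)
  ultimately have "D \<subseteq> Z {f} \<or> D \<subseteq> Z {g}"
    using assms(1) by (auto simp: irreducible_in_def)
  then show ?thesis using assms(5) by (auto simp: Z_def)
qed

section \<open>Algebraic independence and counting\<close>

text \<open>
  Gaussian elimination: each equation removes at most one unknown.
\<close>

lemma underdetermined_system:
  fixes m :: "'b \<Rightarrow> 'c \<Rightarrow> 'a::field"
  assumes "finite K" "finite A" "card K < card A"
  shows "\<exists>c. (\<exists>a\<in>A. c a \<noteq> 0) \<and> (\<forall>k\<in>K. (\<Sum>a\<in>A. c a * m a k) = 0)"
  using assms
proof (induction K arbitrary: A m rule: finite_induct)
  case empty
  then obtain a where "a \<in> A" by fastforce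
  then show ?case by (intro exI[of _ "\<lambda>_. 1"]) auto
next
  case (insert k K)
  show ?case
  proof (cases "\<forall>a\<in>A. m a k = 0")
    case True
    have "card K < card A" using insert by simp
    then obtain c where "\<exists>a\<in>A. c a \<noteq> 0" "\<forall>k\<in>K. (\<Sum>a\<in>A. c a * m a k) = 0"
      using insert by blast
    then show ?thesis using True by (intro exI[of _ c]) auto
  next
    case False
    then obtain b where b: "b \<in> A" "m b k \<noteq> 0" by blast
    define m' where "m' a l = m a l - m a k / m b k * m b l" for a l
    have "card K < card (A - {b})" using insert b by simp
    then obtain c where c: "\<exists>a\<in>A - {b}. c a \<noteq> 0"
        and c0: "\<And>l. l \<in> K \<Longrightarrow> (\<Sum>a\<in>A - {b}. c a * m' a l) = 0"
      using insert.IH[of "A - {b}" m'] insert.prems by blast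
    define c' where "c' = c(b := - (\<Sum>a\<in>A - {b}. c a * (m a k / m b k)))"
    have eq: "(\<Sum>a\<in>A. c' a * m a l) = (\<Sum>a\<in>A - {b}. c a * m' a l)" for l
    proof -
      have "(\<Sum>a\<in>A. c' a * m a l) = c' b * m b l + (\<Sum>a\<in>A - {b}. c a * m a l)"
        unfolding sum.remove[OF insert.prems(1) b(1)] by (auto simp: c'_def intro!: sum.cong)
      also have "c' b * m b l = - (\<Sum>a\<in>A - {b}. c a * (m a k / m b k * m b l))"
        by (simp add: c'_def sum_distrib_right mult.assoc)
      finally show ?thesis
        by (simp add: m'_def right_diff_distrib sum_subtractf)
    qed
    have "m' a k = 0" for a using b(2) by (simp add: m'_def)
    then have "\<forall>l\<in>insert k K. (\<Sum>a\<in>A. c' a * m a l) = 0" using c0 eq by auto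
    moreover have "\<exists>a\<in>A. c' a \<noteq> 0" using c by (auto simp: c'_def)
    ultimately show ?thesis by blast
  qed
qed

fun monomial_in :: "('b \<Rightarrow> 'a::field) list \<Rightarrow> nat list \<Rightarrow> 'b \<Rightarrow> 'a" where
  "monomial_in (f # fs) (k # ks) x = f x ^ k * monomial_in fs ks x"
| "monomial_in _ _ x = 1"

text \<open>
  Exponent vectors in a box rather than of bounded total degree: their number is a plain power.
\<close>

definition exponents :: "nat \<Rightarrow> nat \<Rightarrow> nat list set" where
  "exponents n N = {ks. set ks \<subseteq> {..<N} \<and> length ks = n}"

lemma finite_exponents: "finite (exponents n N)"
  and card_exponents: "card (exponents n N) = N ^ n"
  unfolding exponents_def
  by (simp_all add: finite_lists_length_eq card_lists_length_eq)

lemma exponents_0: "exponents 0 N = {[]}"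
  by (auto simp: exponents_def)

lemma exponents_Suc: "exponents (Suc n) N = case_prod (#) ` ({..<N} \<times> exponents n N)"
  by (fastforce simp: exponents_def length_Suc_conv)

lemma sum_exponents_Suc:
  "(\<Sum>ks\<in>exponents (Suc n) N. h ks) = (\<Sum>k<N. \<Sum>ks\<in>exponents n N. h (k # ks))"
  unfolding exponents_Suc sum.cartesian_product
  by (subst sum.reindex) (auto simp: inj_on_def case_prod_beta)

text \<open>
  This is algebraic independence of the restrictions to \<open>S\<close>, tested on one box of exponents at a
  time.
\<close>

definition independent_on :: "'b set \<Rightarrow> ('b \<Rightarrow> 'a::field) list \<Rightarrow> bool" where
  "independent_on S fs \<longleftrightarrow> (\<forall>N c.
     (\<forall>x\<in>S. (\<Sum>ks\<in>exponents (length fs) N. c ks * monomial_in fs ks x) = 0) \<longrightarrow>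
     (\<forall>ks\<in>exponents (length fs) N. c ks = 0))"

lemma poly_fun_power: "f \<in> poly_fun \<Longrightarrow> (\<lambda>x. f x ^ k) \<in> poly_fun"
  by (induction k) (auto intro: poly_fun.intros)

lemma poly_fun_sum: "(\<And>i. i \<in> I \<Longrightarrow> f i \<in> poly_fun) \<Longrightarrow> (\<lambda>x. \<Sum>i\<in>I. f i x) \<in> poly_fun"
  by (induction I rule: infinite_finite_induct) (auto intro: poly_fun.intros)

lemma monomial_in_Nil: "monomial_in [] ks = (\<lambda>_. 1)" "monomial_in fs [] = (\<lambda>_. 1)"
  by (cases fs; simp add: fun_eq_iff)+

lemma poly_fun_monomial_in: "set fs \<subseteq> poly_fun \<Longrightarrow> monomial_in fs ks \<in> poly_fun"
proof (induction fs ks rule: list_induct2')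
  case (4 f fs k ks)
  have "monomial_in (f # fs) (k # ks) = (\<lambda>x. f x ^ k * monomial_in fs ks x)" by (simp add: fun_eq_iff)
  then show ?case using 4 by (simp add: poly_fun.mult poly_fun_power)
qed (simp_all add: monomial_in_Nil poly_fun.const)

text \<open>
  Order a relation between \<open>f\<close> and \<open>fs\<close> on \<open>D\<close> by powers of \<open>f\<close> and divide by the lowest power
  that occurs, which is permitted because \<open>D\<close> is irreducible. On \<open>C\<close>, where \<open>f\<close> vanishes, only
  the lowest coefficient survives. It is a relation between the \<open>fs\<close> on \<open>C\<close>, hence trivial.
\<close>

lemma independent_on_Cons:
  assumes indep: "independent_on C fs" and fs: "set fs \<subseteq> poly_fun" and f: "f \<in> poly_fun"
    and sub: "C \<subseteq> D" and irr: "irreducible_in zariski D"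
    and fC: "\<forall>x\<in>C. f x = 0" and fD: "\<exists>x\<in>D. f x \<noteq> 0"
  shows "independent_on D (f # fs)"
  unfolding independent_on_def
proof (intro allI impI)
  fix N c
  let ?E = "exponents (length fs) N"
  define P where "P k x = (\<Sum>ks\<in>?E. c (k # ks) * monomial_in fs ks x)" for k x
  assume "\<forall>x\<in>D. (\<Sum>ks\<in>exponents (length (f # fs)) N. c ks * monomial_in (f # fs) ks x) = 0"
  then have rel: "(\<Sum>k<N. f x ^ k * P k x) = 0" if "x \<in> D" for x
    using that by (simp add: sum_exponents_Suc P_def sum_distrib_left mult_ac)
  have "\<forall>ks\<in>?E. c (k # ks) = 0" if "k < N" for k
    using that
  proof (induction k rule: less_induct)
    case (less k)
    define R where "R x = (\<Sum>i\<in>{k..<N}. f x ^ (i - k) * P i x)" for x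
    have "f x ^ k * R x = 0" if "x \<in> D" for x
    proof -
      have "(\<Sum>i<N. f x ^ i * P i x) = (\<Sum>i\<in>{k..<N}. f x ^ i * P i x)"
        by (rule sum.mono_neutral_right) (use less in \<open>auto simp: P_def\<close>)
      also have "\<dots> = f x ^ k * R x"
        unfolding R_def sum_distrib_left
        by (rule sum.cong) (auto simp flip: power_add mult.assoc)
      finally show ?thesis using rel[OF that] by simp
    qed
    moreover have "(\<lambda>x. P k x) \<in> poly_fun" for k
      unfolding P_def
      by (intro poly_fun_sum poly_fun.mult poly_fun.const poly_fun_monomial_in fs)
    then have "R \<in> poly_fun" unfolding R_def
      by (intro poly_fun_sum poly_fun.mult poly_fun_power f) auto
    moreover have "\<exists>x\<in>D. f x ^ k \<noteq> 0" using fD by auto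
    ultimately have R: "\<forall>x\<in>D. R x = 0"
      using irreducible_in_zariski_mult[OF irr poly_fun_power[OF f]] by blast
    have "P k x = 0" if "x \<in> C" for x
    proof -
      have "R x = (\<Sum>i\<in>{k}. f x ^ (i - k) * P i x)"
        unfolding R_def using that fC less.prems
        by (intro sum.mono_neutral_right) auto
      then show ?thesis using R sub that by auto
    qed
    then have "\<forall>x\<in>C. (\<Sum>ks\<in>?E. c (k # ks) * monomial_in fs ks x) = 0" by (simp add: P_def)
    then show ?case
      using indep[unfolded independent_on_def, rule_format, of "\<lambda>ks. c (k # ks)" N] by blast
  qed
  then show "\<forall>ks\<in>exponents (length (f # fs)) N. c ks = 0"
    by (auto simp: exponents_Suc)
qed

text \<open>
  The degree is bounded in each coordinate separately, so that there are \<open>(d + 1)\<^sup>4\<close> monomials.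
\<close>

inductive_set box_span :: "nat \<Rightarrow> ('a::field^5^5 \<Rightarrow> 'a) set" for d where
  monomial: "(\<And>r. m r \<le> d) \<Longrightarrow> (\<lambda>x. \<Prod>r\<in>UNIV. X r x ^ m r) \<in> box_span d"
| add: "f \<in> box_span d \<Longrightarrow> g \<in> box_span d \<Longrightarrow> (\<lambda>x. f x + g x) \<in> box_span d"
| scale: "f \<in> box_span d \<Longrightarrow> (\<lambda>x. c * f x) \<in> box_span d"

lemma box_span_mono: "f \<in> box_span d \<Longrightarrow> d \<le> e \<Longrightarrow> f \<in> box_span e"
proof (induction rule: box_span.induct)
  case (monomial m)
  then have "m r \<le> e" for r using le_trans by blast
  then show ?case by (rule box_span.monomial)
qed (auto intro: box_span.intros)

lemma box_span_mult:
  assumes "f \<in> box_span d" "g \<in> box_span e"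
  shows "(\<lambda>x. f x * g x) \<in> box_span (d + e)"
  using assms(1)
proof induction
  case (monomial m)
  show ?case using assms(2)
  proof induction
    case (monomial n)
    have "(\<lambda>x. \<Prod>r\<in>UNIV. X r x ^ (m r + n r)) \<in> box_span (d + e)"
      by (rule box_span.monomial) (use \<open>\<And>r. m r \<le> d\<close> monomial in \<open>simp add: add_mono\<close>)
    then show ?case by (simp add: power_add prod.distrib)
  next
    case (add g h)
    then show ?case using box_span.add[OF add.IH] by (simp add: distrib_left)
  next
    case (scale g c)
    then show ?case using box_span.scale[OF scale.IH, of c] by (simp add: mult.left_commute)
  qed
next
  case (add f h)
  then show ?case using box_span.add[OF add.IH] by (simp add: distrib_right)
next
  case (scale f c)
  then show ?case using box_span.scale[OF scale.IH, of c] by (simp add: mult.assoc)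
qed

lemma box_span_const: "(\<lambda>_. c) \<in> box_span d"
  using box_span.scale[OF box_span.monomial[of "\<lambda>_. 0" d], of c] by simp

lemma poly_fun_box_span:
  assumes "f \<in> poly_fun"
  shows "\<exists>d. f \<in> box_span d"
  using assms
proof induction
  case (const c)
  then show ?case using box_span_const by blast
next
  case (coord r)
  have "(\<lambda>x. \<Prod>s\<in>UNIV. X s x ^ (if s = r then 1 else 0)) \<in> box_span 1"
    by (rule box_span.monomial) simp
  also have "(\<lambda>x. \<Prod>s\<in>UNIV. X s x ^ (if s = r then 1 else 0)) = X r"
    by (simp add: fun_eq_iff if_distrib[of "\<lambda>k. _ ^ k"] cong: if_cong)
  finally show ?case by blast
next
  case (add f g)
  then obtain d e where "f \<in> box_span d" "g \<in> box_span e" by blast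
  then have "(\<lambda>x. f x + g x) \<in> box_span (max d e)"
    using box_span_mono[of f d "max d e"] box_span_mono[of g e "max d e"]
    by (intro box_span.add) simp_all
  then show ?case by blast
next
  case (mult f g)
  then show ?case using box_span_mult by blast
qed

lemma box_span_power: "f \<in> box_span d \<Longrightarrow> (\<lambda>x. f x ^ k) \<in> box_span (d * k)"
proof (induction k)
  case (Suc k)
  then show ?case using box_span_mult[of f d "\<lambda>x. f x ^ k"] by simp
qed (simp add: box_span_const)

lemma box_span_monomial_in:
  "set fs \<subseteq> box_span d \<Longrightarrow> ks \<in> exponents (length fs) N \<Longrightarrow>
    monomial_in fs ks \<in> box_span (length fs * (d * N))"
proof (induction fs arbitrary: ks)
  case Nil
  then show ?case using box_span_const[of 1] by (simp add: fun_eq_iff)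
next
  case (Cons f fs)
  then obtain k ls where ks: "ks = k # ls" "k < N" "ls \<in> exponents (length fs) N"
    by (auto simp: exponents_Suc)
  have "(\<lambda>x. f x ^ k) \<in> box_span (d * N)"
    using Cons.prems(1) ks(2) by (intro box_span_mono[OF box_span_power]) auto
  then have "(\<lambda>x. f x ^ k * monomial_in fs ls x) \<in> box_span (d * N + length fs * (d * N))"
    using Cons ks(3) by (intro box_span_mult) auto
  then show ?case by (simp add: ks(1) fun_eq_iff)
qed

definition box :: "nat \<Rightarrow> (pos_root \<Rightarrow> nat) set" where
  "box d = {m. \<forall>r. m r \<le> d}"

lemma finite_box: "finite (box d)" and card_box: "card (box d) = (d + 1) ^ 4"
proof -
  have "box d = PiE UNIV (\<lambda>_. {..d})" by (auto simp: box_def PiE_def)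
  moreover have "card (UNIV :: pos_root set) = 4" by (simp add: UNIV_pos_root)
  ultimately show "finite (box d)" "card (box d) = (d + 1) ^ 4"
    by (simp_all add: card_PiE finite_PiE)
qed

lemma box_span_coeffs:
  assumes "f \<in> box_span d"
  shows "\<exists>c. \<forall>x. f x = (\<Sum>m\<in>box d. c m * (\<Prod>r\<in>UNIV. X r x ^ m r))"
  using assms
proof induction
  case (monomial m)
  then have "m \<in> box d" by (simp add: box_def)
  then show ?case
    by (intro exI[of _ "\<lambda>n. if n = m then 1 else 0"])
      (simp add: finite_box if_distrib[of "\<lambda>z. z * _"] cong: if_cong)
next
  case (add f g)
  then obtain c c' where "\<forall>x. f x = (\<Sum>m\<in>box d. c m * (\<Prod>r\<in>UNIV. X r x ^ m r))"
    "\<forall>x. g x = (\<Sum>m\<in>box d. c' m * (\<Prod>r\<in>UNIV. X r x ^ m r))" by blast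
  then show ?case
    by (intro exI[of _ "\<lambda>m. c m + c' m"]) (simp add: distrib_right sum.distrib)
next
  case (scale f b)
  then obtain c where "\<forall>x. f x = (\<Sum>m\<in>box d. c m * (\<Prod>r\<in>UNIV. X r x ^ m r))" by blast
  then show ?case
    by (intro exI[of _ "\<lambda>m. b * c m"]) (simp add: sum_distrib_left mult.assoc)
qed

text \<open>
  Suppose that there are \<open>n \<ge> 5\<close> independent functions of degree at most \<open>d\<close> in each coordinate.
  Their \<open>N\<^sup>n\<close> monomials with exponents below \<open>N\<close> are linearly independent and lie in a space of
  dimension at most \<open>(ndN + 1)\<^sup>4\<close>. For large \<open>N\<close> this is less than \<open>N\<^sup>5\<close>.
\<close>

lemma independent_on_length_le_4:
  assumes indep: "independent_on S fs" and fs: "set fs \<subseteq> poly_fun"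
  shows "length fs \<le> 4"
proof (rule ccontr)
  let ?n = "length fs"
  assume n: "\<not> ?n \<le> 4"
  have "\<exists>d. set fs \<subseteq> box_span d" using fs
  proof (induction fs)
    case (Cons f fs)
    then obtain d where "f \<in> box_span d" using poly_fun_box_span[of f] by auto
    moreover obtain e where "set fs \<subseteq> box_span e" using Cons by auto
    ultimately
    have "set (f # fs) \<subseteq> box_span (max d e)"
      using box_span_mono[OF _ max.cobounded1, of _ d e] box_span_mono[OF _ max.cobounded2, of _ e d]
      by auto
    then show ?case by blast
  qed simp
  then obtain d where d: "set fs \<subseteq> box_span d" by blast
  \<comment> \<open>With this \<open>N\<close>, \<open>(ndN + 1)\<^sup>4 \<le> (nd + 1)\<^sup>4 N\<^sup>4 = (N - 1) N\<^sup>4 < N\<^sup>5\<close>.\<close>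
  define N where "N = (?n * d + 1) ^ 4 + 1"
  let ?e = "?n * (d * N)" and ?E = "exponents ?n N"
  have "\<forall>ks\<in>?E. \<exists>c. \<forall>x. monomial_in fs ks x = (\<Sum>m\<in>box ?e. c m * (\<Prod>r\<in>UNIV. X r x ^ m r))"
    using box_span_monomial_in[OF d] box_span_coeffs by blast
  from bchoice[OF this] obtain a where a: "\<And>ks x. ks \<in> ?E \<Longrightarrow>
      monomial_in fs ks x = (\<Sum>m\<in>box ?e. a ks m * (\<Prod>r\<in>UNIV. X r x ^ m r))"
    by blast
  have "card (box ?e) < card ?E"
  proof -
    have "?e + 1 \<le> (?n * d + 1) * N" by (simp add: N_def algebra_simps)
    then have "(?e + 1) ^ 4 \<le> ((?n * d + 1) * N) ^ 4" by (rule power_mono) simp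
    also have "\<dots> = (?n * d + 1) ^ 4 * N ^ 4" by (rule power_mult_distrib)
    also have "\<dots> = (N - 1) * N ^ 4" by (simp add: N_def)
    also have "\<dots> < N * N ^ 4" by (simp add: N_def)
    also have "\<dots> = N ^ 5" by (simp add: eval_nat_numeral)
    also have "\<dots> \<le> N ^ ?n" using n by (intro power_increasing) (auto simp: N_def)
    finally show ?thesis by (simp add: card_box card_exponents)
  qed
  then obtain c where c: "\<exists>ks\<in>?E. c ks \<noteq> 0"
      and rel: "\<forall>m\<in>box ?e. (\<Sum>ks\<in>?E. c ks * a ks m) = 0"
    using underdetermined_system[OF finite_box finite_exponents, of ?e ?n N a] by blast
  have "(\<Sum>ks\<in>?E. c ks * monomial_in fs ks x) = 0" for x
  proof -
    have "(\<Sum>ks\<in>?E. c ks * monomial_in fs ks x)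
        = (\<Sum>ks\<in>?E. \<Sum>m\<in>box ?e. (c ks * a ks m) * (\<Prod>r\<in>UNIV. X r x ^ m r))"
      by (rule sum.cong) (simp_all add: a sum_distrib_left mult.assoc)
    also have "\<dots> = (\<Sum>m\<in>box ?e. (\<Sum>ks\<in>?E. c ks * a ks m) * (\<Prod>r\<in>UNIV. X r x ^ m r))"
      by (subst sum.swap) (simp add: sum_distrib_right)
    finally show ?thesis using rel by simp
  qed
  then show False using indep c unfolding independent_on_def by blast
qed

section \<open>Chains of irreducible closed sets\<close>

text \<open>
  The functions collected along an increasing chain of sets, each of them separating one set
  from the next. The larger set of each step is irreducible, but the sets are arbitrary
  otherwise; so a chain of relatively closed subsets of a stratum can be continued by larger
  subspaces of the nilradical.
\<close>

inductive tower :: "('a::field^5^5 \<Rightarrow> 'a) list \<Rightarrow> ('a^5^5) set \<Rightarrow> bool" where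
  base: "S \<noteq> {} \<Longrightarrow> tower [] S"
| step: "tower fs C \<Longrightarrow> C \<subseteq> D \<Longrightarrow> irreducible_in zariski D \<Longrightarrow> f \<in> poly_fun \<Longrightarrow>
    \<forall>x\<in>C. f x = 0 \<Longrightarrow> \<exists>x\<in>D. f x \<noteq> 0 \<Longrightarrow> tower (f # fs) D"

lemma tower_independent: "tower fs S \<Longrightarrow> independent_on S fs \<and> set fs \<subseteq> poly_fun"
proof (induction rule: tower.induct)
  case (base S)
  then show ?case by (auto simp: independent_on_def exponents_0)
next
  case (step fs C D f)
  then show ?case using independent_on_Cons[of C fs f D] by auto
qed

lemma tower_length_le_4: "tower fs S \<Longrightarrow> length fs \<le> 4"
  using tower_independent independent_on_length_le_4 by blast

text \<open>
  Among the equations of one member of the chain, some equation does not hold on the whole next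
  member.
\<close>

lemma chain_tower:
  assumes "\<And>i. i \<le> n \<Longrightarrow> closedin (subtopology zariski S) (C i)"
    and "\<And>i. i \<le> n \<Longrightarrow> irreducible_in (subtopology zariski S) (C i)"
    and "\<And>i. i < n \<Longrightarrow> C i \<subset> C (Suc i)"
  shows "\<exists>fs. tower fs (C n) \<and> length fs = n"
  using assms
proof (induction n)
  case 0
  then have "C 0 \<noteq> {}" using irreducible_in_def by blast
  then show ?case using tower.base[of "C 0"] by (intro exI[of _ "[]"]) simp
next
  case (Suc n)
  then obtain fs where fs: "tower fs (C n)" "length fs = n" by auto
  have "closedin (subtopology zariski S) (C n)" using Suc by simp
  then obtain F where F: "F \<subseteq> poly_fun" "C n = S \<inter> Z F"
    by (auto simp: closedin_subtopology closedin_zariski)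
  have irr: "C (Suc n) \<subseteq> S" "irreducible_in zariski (C (Suc n))"
    using Suc.prems(2)[of "Suc n"] by (auto simp: irreducible_in_subtopology)
  then have "C (Suc n) \<subseteq> nilrad" by (auto simp: irreducible_in_def topspace_zariski)
  moreover have sub: "C n \<subset> C (Suc n)" using Suc by simp
  ultimately obtain f where "f \<in> F" "\<exists>x\<in>C (Suc n). f x \<noteq> 0"
    using F(2) irr(1) by (auto simp: Z_def)
  then have "tower (f # fs) (C (Suc n))"
    using fs sub irr F by (intro tower.step[of fs "C n"]) (auto simp: Z_def)
  then show ?case using fs(2) by (intro exI[of _ "f # fs"]) simp
qed

lemma variety_dim_leI:
  assumes "\<And>fs C. tower fs C \<Longrightarrow> C \<subseteq> S \<Longrightarrow> length fs \<le> n"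
  shows "variety_dim S \<le> enat n"
  unfolding variety_dim_def krull_dim_def
proof (rule Sup_least, clarify)
  fix k and C :: "nat \<Rightarrow> ('a^5^5) set"
  assume C: "\<forall>i\<le>k. closedin (subtopology zariski S) (C i) \<and>
      irreducible_in (subtopology zariski S) (C i)"
    "\<forall>i<k. C i \<subset> C (Suc i)"
  then obtain fs where "tower fs (C k)" "length fs = k" using chain_tower[of k S C] by blast
  moreover have "C k \<subseteq> S" using C(1) by (simp add: irreducible_in_subtopology)
  ultimately show "enat k \<le> enat n" using assms by auto
qed

definition slice :: "('a::field^5^5) set \<Rightarrow> 'a^5^5 \<Rightarrow> pos_root set \<Rightarrow> ('a^5^5) set" where
  "slice S p R = {x \<in> S. \<forall>r\<in>R. X r x = X r p}"

lemma closedin_slice: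
  assumes "S \<subseteq> nilrad"
  shows "closedin (subtopology zariski S) (slice S p R)"
proof -
  let ?F = "(\<lambda>r x. X r x + (- X r p)) ` R"
  have "?F \<subseteq> poly_fun"
    using poly_fun.add[OF poly_fun.coord poly_fun.const] by blast
  then have "closedin zariski (Z ?F)" by (auto simp: closedin_zariski)
  moreover have "slice S p R = Z ?F \<inter> S" using assms by (auto simp: slice_def Z_def)
  ultimately show ?thesis by (auto simp: closedin_subtopology)
qed

text \<open>
  Releasing the coordinates in \<open>rs\<close> one at a time, starting from the last one, gives a chain of
  slices.
\<close>

lemma variety_dim_geI:
  assumes "S \<subseteq> nilrad"
    and irr: "\<And>i. i \<le> length rs \<Longrightarrow> irreducible_in zariski (slice S p (set (take i rs)))"
    and free: "\<And>i. i < length rs \<Longrightarrow>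
      \<exists>x\<in>slice S p (set (take i rs)). X (rs ! i) x \<noteq> X (rs ! i) p"
  shows "enat (length rs) \<le> variety_dim S"
  unfolding variety_dim_def krull_dim_def
proof (rule Sup_upper, rule CollectI,
    rule exI[of _ "length rs"], rule conjI[OF refl],
    rule exI[of _ "\<lambda>i. slice S p (set (take (length rs - i) rs))"], intro conjI allI impI)
  let ?n = "length rs"
  let ?C = "\<lambda>i. slice S p (set (take (?n - i) rs))"
  fix i
  show "closedin (subtopology zariski S) (?C i)" using assms(1) by (rule closedin_slice)
  show "irreducible_in (subtopology zariski S) (?C i)"
    using irr by (auto simp: irreducible_in_subtopology slice_def)
  assume "i < ?n"
  then have i: "?n - i = Suc (?n - Suc i)" and lt: "?n - Suc i < ?n" by auto
  have "set (take (?n - i) rs) = insert (rs ! (?n - Suc i)) (set (take (?n - Suc i) rs))"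
    unfolding i using lt by (simp add: take_Suc_conv_app_nth)
  then show "?C i \<subset> ?C (Suc i)"
    using free[OF lt] by (auto simp: slice_def)
qed

section \<open>The adjoint action in coordinates\<close>

definition nvec :: "'a::field \<Rightarrow> 'a \<Rightarrow> 'a \<Rightarrow> 'a \<Rightarrow> 'a^5^5" where
  "nvec a b c d = lincomb
    (\<lambda>r. case r of Alpha1 \<Rightarrow> a | Alpha2 \<Rightarrow> b | Alpha1_Alpha2 \<Rightarrow> c | Alpha1_2Alpha2 \<Rightarrow> d)"

lemma X_nvec [simp]:
  "X Alpha1 (nvec a b c d) = a" "X Alpha2 (nvec a b c d) = b"
  "X Alpha1_Alpha2 (nvec a b c d) = c" "X Alpha1_2Alpha2 (nvec a b c d) = d"
  by (simp_all add: nvec_def X_lincomb)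

lemma lincomb_eq_nvec:
  "lincomb a = nvec (a Alpha1) (a Alpha2) (a Alpha1_Alpha2) (a Alpha1_2Alpha2)"
proof -
  have "a = (\<lambda>r. case r of Alpha1 \<Rightarrow> a Alpha1 | Alpha2 \<Rightarrow> a Alpha2
      | Alpha1_Alpha2 \<Rightarrow> a Alpha1_Alpha2 | Alpha1_2Alpha2 \<Rightarrow> a Alpha1_2Alpha2)"
    by (simp add: fun_eq_iff split: pos_root.split)
  then show ?thesis by (simp add: nvec_def)
qed

lemma nvec_in_nilrad [simp]: "nvec a b c d \<in> nilrad"
  by (simp add: nvec_def nilrad_def)

lemma nilrad_cases:
  assumes "x \<in> nilrad"
  obtains a b c d where "x = nvec a b c d"
  using assms unfolding nilrad_def lincomb_eq_nvec by blast

lemma nvec_eq_iff [simp]: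
  "nvec a b c d = nvec a' b' c' d' \<longleftrightarrow> a = a' \<and> b = b' \<and> c = c' \<and> d = d'"
  by (metis X_nvec)

lemma nvec_entries:
  "nvec a b c d $ i $ j =
    (if (i, j) = (2, 3) then a else if (i, j) = (5, 4) then - a
     else if (i, j) = (1, 5) then b else if (i, j) = (3, 1) then - b
     else if (i, j) = (1, 4) then c else if (i, j) = (2, 1) then - c
     else if (i, j) = (2, 5) then d else if (i, j) = (3, 4) then - d else 0)"
  using exhaust_5[of i] exhaust_5[of j]
  by (elim disjE) (simp_all add: nvec_def lincomb_def UNIV_pos_root mat_mult_component munit_def)

lemma root_vec_nvec:
  "(0 :: 'a::field^5^5) = nvec 0 0 0 0"
  "(root_vec Alpha1 :: 'a^5^5) = nvec 1 0 0 0"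
  "(root_vec Alpha2 :: 'a^5^5) = nvec 0 1 0 0"
  "(root_vec Alpha1_Alpha2 :: 'a^5^5) = nvec 0 0 1 0"
  "(root_vec Alpha1_2Alpha2 :: 'a^5^5) = nvec 0 0 0 1"
  "(nvec 1 0 0 0 + nvec 0 0 0 1 :: 'a^5^5) = nvec 1 0 0 1"
  "(nvec 1 0 0 0 + nvec 0 1 0 0 :: 'a^5^5) = nvec 1 1 0 0"
  by (simp_all add: matrix_eq_entries forall_5 nvec_entries munit_def)

text \<open>
  Commuting \<open>g\<close> past \<open>x\<close> avoids computing its inverse.
\<close>

lemma Ad_eqI:
  assumes "g \<in> carrier SO5" "g ** x = y ** g"
  shows "Ad g x = y"
proof -
  have "g ** x ** adjoint_J g = y ** (g ** adjoint_J g)"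
    using assms(2) by (simp add: matrix_mul_assoc)
  then show ?thesis using assms(1) by (simp add: Ad_SO5 SO5_adjoint_J)
qed

lemma Ad_torus_elt:
  assumes "s \<noteq> 0" "t \<noteq> 0"
  shows "Ad (torus_elt s t) (nvec a b c d) = nvec (s / t * a) (t * b) (s * c) (s * t * d)"
  using assms
  by (intro Ad_eqI torus_elt_in_SO5 assms)
    (simp add: matrix_eq_entries forall_5 matrix_mult_5 torus_elt_entries nvec_entries field_simps)

text \<open>
  Only the terms that raise the root appear: \<open>\<alpha>\<^sub>1\<close> and \<open>\<alpha>\<^sub>2\<close> contribute to \<open>\<alpha>\<^sub>1 + \<alpha>\<^sub>2\<close>, and all
  three lower roots contribute to \<open>\<alpha>\<^sub>1 + 2\<alpha>\<^sub>2\<close>. The square appears because \<open>\<alpha>\<^sub>2\<close> can be added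
  twice to \<open>\<alpha>\<^sub>1\<close>.
\<close>

lemma Ad_unip:
  fixes a b c d :: "'a::field"
  assumes two: "(2 :: 'a) \<noteq> 0" and g: "unip p q r s \<in> carrier SO5"
  shows "Ad (unip p q r s) (nvec a b c d)
    = nvec a b (c + p * b - a * q) (d - b * r + c * q - a * (q^2 / 2))"
proof -
  define h where "h = q^2 / 2"
  define k where "k = r^2 / 2"
  have h: "q * q = h + h" "r * r = k + k"
    using two by (simp_all add: h_def k_def power2_eq_square flip: mult_2)
  show ?thesis
    by (rule Ad_eqI[OF g],
        simp add: matrix_eq_entries forall_5 matrix_mult_5 unip_def nvec_entries flip: h_def k_def,
        simp add: algebra_simps power2_eq_square h)
qed

section \<open>The orbits\<close>

lemma orbit_refl:
  "x \<in> orbit (borel_SO5 :: ('a::field^5^5) monoid) Ad x"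
proof -
  have "mat 1 \<in> carrier (borel_SO5 :: ('a^5^5) monoid)"
    using subgroup.one_closed[OF borel_SO5_subgroup] by (simp add: SO5_one)
  then show ?thesis unfolding orbit_def by (intro CollectI exI[of _ "mat 1"]) simp
qed

lemma orbit_step:
  assumes y: "y \<in> orbit (borel_SO5 :: ('a::field^5^5) monoid) Ad x" and g: "g \<in> carrier borel_SO5"
  shows "Ad g y \<in> orbit borel_SO5 Ad x"
proof -
  obtain h where h: "h \<in> carrier borel_SO5" "y = Ad h x" using y by (auto simp: orbit_def)
  have "g ** h \<in> carrier borel_SO5"
    using subgroup.m_closed[OF borel_SO5_subgroup g h(1)] by (simp add: SO5_mult)
  moreover have "Ad g y = Ad (g ** h) x"
    using Ad_mult[OF subgroup.mem_carrier[OF borel_SO5_subgroup g]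
        subgroup.mem_carrier[OF borel_SO5_subgroup h(1)]] h(2) by simp
  ultimately show ?thesis unfolding orbit_def by (intro CollectI exI[of _ "g ** h"]) simp
qed

lemma orbit_eqI:
  assumes y: "y \<in> orbit (borel_SO5 :: ('a::field^5^5) monoid) Ad x"
  shows "orbit borel_SO5 Ad y = orbit borel_SO5 Ad x"
proof
  show "orbit borel_SO5 Ad y \<subseteq> orbit borel_SO5 Ad x"
    using orbit_step[OF y] by (auto simp: orbit_def[of _ _ y])
  obtain h where h: "h \<in> carrier borel_SO5" "y = Ad h x" using y by (auto simp: orbit_def)
  have S: "h \<in> carrier SO5" using subgroup.mem_carrier[OF borel_SO5_subgroup h(1)] .
  have h': "adjoint_J h \<in> carrier borel_SO5"
    using subgroup.m_inv_closed[OF borel_SO5_subgroup h(1)] by (simp add: inv_SO5[OF S])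
  have "Ad (adjoint_J h) y = x"
    using Ad_mult[OF SO5_adjoint_J(3)[OF S] S, of x] h(2) by (simp add: SO5_adjoint_J[OF S])
  then have "x \<in> orbit borel_SO5 Ad y" using orbit_step[OF orbit_refl h'] by metis
  then show "orbit borel_SO5 Ad x \<subseteq> orbit borel_SO5 Ad y"
    using orbit_step[of x y] by (auto simp: orbit_def[of _ _ x])
qed

lemma torus_elt_in_borel:
  fixes s t :: "'a::field"
  assumes "s \<noteq> 0" "t \<noteq> 0"
  shows "torus_elt s t \<in> carrier borel_SO5"
  unfolding carrier_borel_SO5 using assms subgroup.one_closed[OF unipotent_radical_subgroup]
  by (intro CollectI exI[of _ s] exI[of _ t] exI[of _ "mat 1"]) (simp add: SO5_one)

lemma unipotent_radical_in_borel:
  fixes u :: "'a::field^5^5"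
  assumes "u \<in> unipotent_radical"
  shows "u \<in> carrier borel_SO5"
proof -
  have "torus_elt 1 1 = (mat 1 :: 'a^5^5)"
    by (simp add: matrix_eq_entries torus_elt_entries mat_def)
  then show ?thesis unfolding carrier_borel_SO5 using assms
    by (intro CollectI exI[of _ 1] exI[of _ u]) simp
qed

lemma borel_SO5_cases:
  assumes two: "(2 :: 'a::alg_closed_field) \<noteq> 0" and g: "g \<in> carrier (borel_SO5 :: ('a^5^5) monoid)"
  obtains s t p q r z where "s \<noteq> 0" "t \<noteq> 0" "unip p q r z \<in> carrier SO5"
    "g = torus_elt s t ** unip p q r z"
proof -
  obtain s t u where g: "g = torus_elt s t ** u" "s \<noteq> 0" "t \<noteq> 0" "u \<in> unipotent_radical"
    using g by (auto simp: carrier_borel_SO5)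
  then have u: "u \<in> carrier SO5" "unitriangular u" using unipotent_radical_unitriangular by auto
  then have "u = unip (u$2$3) (u$1$5) (u$1$4) (u$2$5)"
    by (intro unitriangular_isometry_eq_unip two) (simp_all add: carrier_SO5)
  then show ?thesis using that g u by metis
qed

text \<open>
  The moves by the torus and by the root groups of \<open>\<alpha>\<^sub>1\<close>, \<open>\<alpha>\<^sub>2\<close> and \<open>\<alpha>\<^sub>1 + \<alpha>\<^sub>2\<close>. The root group
  of the highest root acts trivially.
\<close>

lemma orbit_moves:
  fixes x :: "'a::field^5^5"
  assumes two: "(2 :: 'a) \<noteq> 0" and y: "nvec a b c d \<in> orbit borel_SO5 Ad x"
  shows "s \<noteq> 0 \<Longrightarrow> t \<noteq> 0 \<Longrightarrow> nvec (s / t * a) (t * b) (s * c) (s * t * d) \<in> orbit borel_SO5 Ad x"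
    and "nvec a b (c + p * b) d \<in> orbit borel_SO5 Ad x"
    and "nvec a b (c - a * q) (d + c * q - a * (q^2 / 2)) \<in> orbit borel_SO5 Ad x"
    and "nvec a b c (d - b * r) \<in> orbit borel_SO5 Ad x"
proof -
  show "nvec (s / t * a) (t * b) (s * c) (s * t * d) \<in> orbit borel_SO5 Ad x"
    if "s \<noteq> 0" "t \<noteq> 0"
    using orbit_step[OF y torus_elt_in_borel[OF that]] by (simp add: Ad_torus_elt that)
  have *: "Ad (root_unip \<gamma> z) (nvec a b c d) \<in> orbit borel_SO5 Ad x" for \<gamma> z
    by (intro orbit_step y unipotent_radical_in_borel root_unip_in_unipotent_radical two)
  have S: "root_unip \<gamma> z \<in> carrier SO5" for \<gamma> and z :: 'a
    by (rule root_unip_in_SO5[OF two])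
  show "nvec a b (c + p * b) d \<in> orbit borel_SO5 Ad x"
    using *[of Alpha1 p] S[of Alpha1 p] by (simp add: Ad_unip[OF two])
  show "nvec a b (c - a * q) (d + c * q - a * (q^2 / 2)) \<in> orbit borel_SO5 Ad x"
    using *[of Alpha2 q] S[of Alpha2 q] by (simp add: Ad_unip[OF two])
  show "nvec a b c (d - b * r) \<in> orbit borel_SO5 Ad x"
    using *[of Alpha1_Alpha2 r] S[of Alpha1_Alpha2 r] by (simp add: Ad_unip[OF two])
qed

text \<open>
  The orbits are named after the roots that occur in their representatives: \<open>amn\<close> stands for the
  root \<open>m\<alpha>\<^sub>1 + n\<alpha>\<^sub>2\<close>.
\<close>

datatype orbit_index = Orb_0 | Orb_a12 | Orb_a11 | Orb_a10 | Orb_a01 | Orb_a10_a12 | Orb_a10_a01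

fun orbit_rep :: "orbit_index \<Rightarrow> 'a::field^5^5" where
  "orbit_rep Orb_0 = nvec 0 0 0 0"
| "orbit_rep Orb_a12 = nvec 0 0 0 1"
| "orbit_rep Orb_a11 = nvec 0 0 1 0"
| "orbit_rep Orb_a10 = nvec 1 0 0 0"
| "orbit_rep Orb_a01 = nvec 0 1 0 0"
| "orbit_rep Orb_a10_a12 = nvec 1 0 0 1"
| "orbit_rep Orb_a10_a01 = nvec 1 1 0 0"

text \<open>
  The elements with vanishing \<open>\<alpha>\<^sub>2\<close> coordinate behave like binary quadratic forms under the Levi
  subgroup of the root \<open>\<alpha>\<^sub>2\<close>; up to the scaling of the coordinates, this is the discriminant.
\<close>

definition Delta :: "'a::field^5^5 \<Rightarrow> 'a" where
  "Delta x = (X Alpha1_Alpha2 x)^2 + 2 * X Alpha1 x * X Alpha1_2Alpha2 x"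

lemma Delta_nvec [simp]: "Delta (nvec a b c d) = c^2 + 2 * a * d"
  by (simp add: Delta_def)

fun stratum_closure :: "orbit_index \<Rightarrow> ('a::field^5^5) set" where
  "stratum_closure Orb_0 = Z (X ` {Alpha1, Alpha2, Alpha1_Alpha2, Alpha1_2Alpha2})"
| "stratum_closure Orb_a12 = Z (X ` {Alpha1, Alpha2, Alpha1_Alpha2})"
| "stratum_closure Orb_a11 = Z (X ` {Alpha1, Alpha2})"
| "stratum_closure Orb_a10 = Z {X Alpha2, Delta}"
| "stratum_closure Orb_a01 = Z (X ` {Alpha1})"
| "stratum_closure Orb_a10_a12 = Z (X ` {Alpha2})"
| "stratum_closure Orb_a10_a01 = Z (X ` {})"

text \<open>
  The zeros of this function on the closure of a stratum are the boundary of the stratum.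
\<close>

fun nonvanishing :: "orbit_index \<Rightarrow> 'a::field^5^5 \<Rightarrow> 'a" where
  "nonvanishing Orb_0 = (\<lambda>_. 1)"
| "nonvanishing Orb_a12 = X Alpha1_2Alpha2"
| "nonvanishing Orb_a11 = X Alpha1_Alpha2"
| "nonvanishing Orb_a10 = X Alpha1"
| "nonvanishing Orb_a01 = X Alpha2"
| "nonvanishing Orb_a10_a12 = (\<lambda>x. X Alpha1 x * Delta x)"
| "nonvanishing Orb_a10_a01 = (\<lambda>x. X Alpha1 x * X Alpha2 x)"

definition stratum :: "orbit_index \<Rightarrow> ('a::field^5^5) set" where
  "stratum i = {x \<in> stratum_closure i. nonvanishing i x \<noteq> 0}"

lemma Z_nvec: "nvec a b c d \<in> Z F \<longleftrightarrow> (\<forall>f\<in>F. f (nvec a b c d) = 0)"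
  by (simp add: Z_def)

lemma stratum_closure_nilrad: "stratum_closure i \<subseteq> nilrad"
  by (cases i) (auto simp: Z_def)

lemma stratum_nilrad: "stratum i \<subseteq> nilrad"
  using stratum_closure_nilrad by (auto simp: stratum_def)

lemma orbit_rep_in_stratum:
  assumes "(2 :: 'a::field) \<noteq> 0"
  shows "(orbit_rep i :: 'a^5^5) \<in> stratum i"
  using assms by (cases i) (simp_all add: stratum_def Z_nvec)

lemma stratum_disjoint: "x \<in> stratum i \<Longrightarrow> x \<in> stratum j \<Longrightarrow> i = j"
proof -
  assume x: "x \<in> stratum i" "x \<in> stratum j"
  then obtain a b c d where "x = nvec a b c d" using stratum_nilrad nilrad_cases by blast
  then show "i = j" using x by (cases i; cases j) (auto simp: stratum_def Z_nvec)
qed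

lemma nilrad_strata:
  assumes "x \<in> nilrad"
  shows "\<exists>i. x \<in> stratum i"
proof -
  obtain a b c d where x: "x = nvec a b c d" using assms nilrad_cases by blast
  have "x \<in> stratum
    (if a = 0 then
       if b \<noteq> 0 then Orb_a01 else if c \<noteq> 0 then Orb_a11 else if d \<noteq> 0 then Orb_a12 else Orb_0
     else if b \<noteq> 0 then Orb_a10_a01 else if Delta x = 0 then Orb_a10 else Orb_a10_a12)"
    by (simp add: stratum_def Z_nvec x)
  then show ?thesis by blast
qed

text \<open>
  On \<open>b = 0\<close> the unipotent part preserves the form \<open>c\<^sup>2 + 2ad\<close>, and the torus multiplies it by a
  nonzero square; the other conditions are read off from the triangular shape.
\<close>

lemma stratum_invariant:
  fixes x :: "'a::alg_closed_field^5^5"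
  assumes two: "(2 :: 'a) \<noteq> 0" and x: "x \<in> stratum i" and g: "g \<in> carrier borel_SO5"
  shows "Ad g x \<in> stratum i"
proof -
  obtain a b c d where nv: "x = nvec a b c d" using x stratum_nilrad nilrad_cases by blast
  obtain s t p q r z where st: "s \<noteq> 0" "t \<noteq> 0" and u: "unip p q r z \<in> carrier SO5"
    and g: "g = torus_elt s t ** unip p q r z" using borel_SO5_cases[OF two g] .
  define c' where "c' = c + p * b - a * q"
  define d' where "d' = d - b * r + c * q - a * (q^2 / 2)"
  define A B C D where "A = s / t * a" and "B = t * b" and "C = s * c'" and "D = s * t * d'"
  note defs = A_def B_def C_def D_def
  have Ad: "Ad g x = nvec A B C D"
    unfolding g nv Ad_mult[OF torus_elt_in_SO5[OF st] u] Ad_unip[OF two u] Ad_torus_elt[OF st]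
      c'_def d'_def defs ..
  have "c'^2 + 2 * a * d' = c^2 + 2 * a * d" if "b = 0"
    using two that by (simp add: c'_def d'_def field_simps power2_eq_square)
  moreover have "C^2 + 2 * A * D = s^2 * (c'^2 + 2 * a * d')"
    using st by (simp add: defs field_simps power2_eq_square)
  ultimately have "C^2 + 2 * A * D = 0 \<longleftrightarrow> c^2 + 2 * a * d = 0" if "b = 0"
    using st that by simp
  moreover have "C = 0 \<longleftrightarrow> c = 0" if "a = 0" "b = 0" using st that by (simp add: c'_def C_def)
  moreover have "D = 0 \<longleftrightarrow> d = 0" if "a = 0" "b = 0" "c = 0" using st that by (simp add: d'_def D_def)
  moreover have "A = 0 \<longleftrightarrow> a = 0" "B = 0 \<longleftrightarrow> b = 0" using st by (simp_all add: defs)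
  ultimately show ?thesis using x unfolding Ad unfolding nv
    by (cases i) (auto simp: stratum_def Z_nvec)
qed

text \<open>
  A torus element gives the representative its correct leading coordinates, and root group
  elements then fill in the remaining ones. For the orbit of the sum of the root vectors of
  \<open>\<alpha>\<^sub>1\<close> and \<open>\<alpha>\<^sub>1 + 2\<alpha>\<^sub>2\<close>, the torus element has to produce two prescribed coordinates \<open>s / t\<close>
  and \<open>s t\<close>, which needs a square root.
\<close>

lemma orbit_of_rep:
  assumes two: "(2 :: 'a::alg_closed_field) \<noteq> 0"
  shows "orbit borel_SO5 Ad (orbit_rep i :: 'a^5^5) = stratum i"
proof
  show "orbit borel_SO5 Ad (orbit_rep i) \<subseteq> (stratum i :: ('a^5^5) set)"
    using stratum_invariant[OF two orbit_rep_in_stratum[OF two]] by (auto simp: orbit_def)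
next
  show "(stratum i :: ('a^5^5) set) \<subseteq> orbit borel_SO5 Ad (orbit_rep i)"
  proof
    fix x :: "'a^5^5" assume x: "x \<in> stratum i"
    then obtain a b c d where nv: "x = nvec a b c d" using stratum_nilrad nilrad_cases by blast
    have o: "(orbit_rep i :: 'a^5^5) \<in> orbit borel_SO5 Ad (orbit_rep i)" by (rule orbit_refl)
    note move = orbit_moves[OF two, of _ _ _ _ "orbit_rep i"]
    let ?O = "orbit borel_SO5 Ad (orbit_rep i :: 'a^5^5)"
    show "x \<in> ?O"
    proof (cases i)
      case Orb_0
      then show ?thesis using x o by (simp add: nv stratum_def Z_nvec)
    next
      case Orb_a12
      then have d: "a = 0" "b = 0" "c = 0" "d \<noteq> 0" using x by (auto simp: nv stratum_def Z_nvec)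
      have "nvec 0 0 0 1 \<in> ?O" using o Orb_a12 by simp
      from move(1)[OF this, of d 1] show ?thesis using d by (simp add: nv)
    next
      case Orb_a11
      then have c: "a = 0" "b = 0" "c \<noteq> 0" using x by (auto simp: nv stratum_def Z_nvec)
      have "nvec 0 0 1 0 \<in> ?O" using o Orb_a11 by simp
      from move(1)[OF this, of c 1] have "nvec 0 0 c 0 \<in> ?O"
        using c by simp
      from move(3)[OF this, of "d / c"] show ?thesis using c by (simp add: nv)
    next
      case Orb_a10
      then have a: "a \<noteq> 0" "b = 0" and "c^2 + 2 * a * d = 0"
        using x by (auto simp: nv stratum_def Z_nvec)
      then have d: "d = - (a * ((- (c / a))^2 / 2))"
        using two by (simp add: field_simps power2_eq_square add_eq_0_iff)
      have "nvec 1 0 0 0 \<in> ?O" using o Orb_a10 by simp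
      from move(1)[OF this, of a 1] have "nvec a 0 0 0 \<in> ?O"
        using a by simp
      from move(3)[OF this, of "- (c / a)"] show ?thesis using a by (simp add: nv d)
    next
      case Orb_a01
      then have b: "a = 0" "b \<noteq> 0" using x by (auto simp: nv stratum_def Z_nvec)
      have "nvec 0 1 0 0 \<in> ?O" using o Orb_a01 by simp
      from move(1)[OF this, of 1 b] have "nvec 0 b 0 0 \<in> ?O"
        using b by simp
      from move(2)[OF this, of "c / b"] have "nvec 0 b c 0 \<in> ?O"
        using b by simp
      from move(4)[OF this, of "- (d / b)"] show ?thesis using b by (simp add: nv)
    next
      case Orb_a10_a12
      \<comment> \<open>The last coordinate that remains once \<open>c\<close> is moved to \<open>0\<close>: \<open>2ae = c\<^sup>2 + 2ad\<close>.\<close>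
      define e where "e = (c^2 + 2 * a * d) / (2 * a)"
      have a: "a \<noteq> 0" "b = 0" "e \<noteq> 0"
        using x Orb_a10_a12 two by (auto simp: nv stratum_def Z_nvec e_def)
      have d: "d = e - a * ((- (c / a))^2 / 2)"
        using two four_neq_0[OF two] a by (simp add: e_def field_simps power2_eq_square)
      obtain s where s: "s^2 = a * e" using nth_root_exists[of 2 "a * e"] by auto
      have s0: "s \<noteq> 0" using s a by auto
      have "nvec 1 0 0 1 \<in> ?O" using o Orb_a10_a12 by simp
      from move(1)[OF this, of s "s / a"] have "nvec a 0 0 e \<in> ?O"
        using a s0 s by (simp add: power2_eq_square)
      from move(3)[OF this, of "- (c / a)"] show ?thesis using a by (simp add: nv d)
    next
      case Orb_a10_a01
      then have b: "a \<noteq> 0" "b \<noteq> 0" using x by (auto simp: nv stratum_def Z_nvec)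
      have "nvec 1 1 0 0 \<in> ?O" using o Orb_a10_a01 by simp
      from move(1)[OF this, of "a * b" b] have "nvec a b 0 0 \<in> ?O"
        using b by simp
      from move(2)[OF this, of "c / b"] have "nvec a b c 0 \<in> ?O"
        using b by simp
      from move(4)[OF this, of "- (d / b)"] show ?thesis using b by (simp add: nv)
    qed
  qed
qed

lemma orbits_nilrad:
  assumes two: "(2 :: 'a::alg_closed_field) \<noteq> 0"
  shows "orbits borel_SO5 (nilrad :: ('a^5^5) set) Ad = range stratum"
proof
  show "orbits borel_SO5 (nilrad :: ('a^5^5) set) Ad \<subseteq> range stratum"
  proof
    fix Y assume "Y \<in> orbits borel_SO5 (nilrad :: ('a^5^5) set) Ad"
    then obtain x where x: "x \<in> nilrad" "Y = orbit borel_SO5 Ad x" by (auto simp: orbits_def)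
    obtain i where i: "x \<in> stratum i" using nilrad_strata[OF x(1)] by blast
    then show "Y \<in> range stratum"
      using orbit_eqI[of x "orbit_rep i"] x(2) by (simp add: orbit_of_rep[OF two])
  qed
  have "stratum i \<in> orbits borel_SO5 (nilrad :: ('a^5^5) set) Ad" for i
    using orbit_of_rep[OF two, of i] orbit_rep_in_stratum[OF two, of i] stratum_nilrad[of i]
    unfolding orbits_def by blast
  then show "range stratum \<subseteq> orbits borel_SO5 (nilrad :: ('a^5^5) set) Ad" by blast
qed

section \<open>Closures of the orbits\<close>

definition line :: "'a::field^5^5 \<Rightarrow> 'a^5^5 \<Rightarrow> pos_root \<Rightarrow> 'a poly" where
  "line x y r = [:X r x, X r y - X r x:]"

lemma X_line [simp]: "X r (curve (line x y) z) = X r x + z * (X r y - X r x)"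
  by (simp add: curve_def X_lincomb line_def)

lemma nilrad_eqI:
  assumes "x \<in> nilrad" "y \<in> nilrad" "\<And>r. X r x = X r y"
  shows "x = y"
proof -
  obtain a b where "x = lincomb a" "y = lincomb b" using assms(1,2) by (auto simp: nilrad_def)
  moreover from this have "a = b" using assms(3) by (simp add: X_lincomb fun_eq_iff)
  ultimately show ?thesis by simp
qed

definition joined :: "('a::field^5^5) set \<Rightarrow> bool" where
  "joined K \<longleftrightarrow> K \<subseteq> nilrad \<and>
    (\<forall>x\<in>K. \<forall>y\<in>K. \<exists>P. curve P 0 = x \<and> curve P 1 = y \<and> (\<forall>z. curve P z \<in> K))"

lemma joined_slice: "joined (slice nilrad p R)"
  unfolding joined_def
proof (intro conjI ballI)
  fix x y :: "'a^5^5" assume x: "x \<in> slice nilrad p R" and y: "y \<in> slice nilrad p R"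
  then have "curve (line x y) 0 = x" "curve (line x y) 1 = y"
    by (auto simp: slice_def intro!: nilrad_eqI curve_in_nilrad)
  moreover have "curve (line x y) z \<in> slice nilrad p R" for z
    using x y by (simp add: slice_def curve_in_nilrad)
  ultimately show "\<exists>P. curve P 0 = x \<and> curve P 1 = y \<and> (\<forall>z. curve P z \<in> slice nilrad p R)"
    by blast
qed (auto simp: slice_def)

lemma X_zero [simp]: "X r 0 = 0"
  by (cases r) (simp_all add: root_vec_nvec(1))

lemma Z_coords_eq_slice: "Z (X ` R) = slice nilrad 0 R"
  by (auto simp: Z_def slice_def)

text \<open>
  The cone \<open>b = 0, c\<^sup>2 + 2ad = 0\<close> is parametrized by \<open>a = -2u\<^sup>2, c = 2uv, d = v\<^sup>2\<close>, and a line
  in the \<open>(u, v)\<close>-plane becomes a curve on the cone.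
\<close>

lemma joined_quadric_cone:
  assumes two: "(2 :: 'a::alg_closed_field) \<noteq> 0"
  shows "joined (stratum_closure Orb_a10 :: ('a^5^5) set)"
proof -
  let ?q = "\<lambda>u v :: 'a. nvec (- 2 * u^2) 0 (2 * u * v) (v^2)"
  have param: "\<exists>u v. x = ?q u v" if x3: "x \<in> stratum_closure Orb_a10" for x
  proof -
    obtain a b c d where x: "x = nvec a b c d"
      using x3 stratum_closure_nilrad nilrad_cases by blast
    then have eq: "b = 0" "c^2 + 2 * a * d = 0" using x3 by (simp_all add: Z_nvec)
    show ?thesis
    proof (cases "d = 0")
      case True
      obtain u where "u^2 = - (a / 2)" using nth_root_exists[of 2 "- (a / 2)"] by auto
      then show ?thesis using True eq two by (intro exI[of _ u] exI[of _ 0]) (simp add: x)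
    next
      case False
      obtain v where v: "v^2 = d" using nth_root_exists[of 2 d] by auto
      have v0: "v \<noteq> 0" using v False by auto
      have "a * (2 * d) = - (c^2)" using eq by (simp add: eq_neg_iff_add_eq_0 algebra_simps)
      moreover have "2 * d \<noteq> 0" using two False by simp
      ultimately have "a = - (c^2) / (2 * d)" by (metis nonzero_eq_divide_eq)
      also have "\<dots> = - 2 * (c / (2 * v))^2"
        using two v0 four_neq_0[OF two] by (simp add: power2_eq_square field_simps flip: v)
      finally show ?thesis
        using v0 two v eq by (intro exI[of _ "c / (2 * v)"] exI[of _ v]) (simp add: x)
    qed
  qed
  show ?thesis unfolding joined_def
  proof (intro conjI ballI stratum_closure_nilrad)
    fix x y :: "'a^5^5" assume "x \<in> stratum_closure Orb_a10" "y \<in> stratum_closure Orb_a10"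
    then obtain u v u' v' where x: "x = ?q u v" and y: "y = ?q u' v'" using param by metis
    define U V where "U = [:u, u' - u:]" and "V = [:v, v' - v:]"
    define P where "P r = (case r of Alpha1 \<Rightarrow> [:-2:] * U^2 | Alpha2 \<Rightarrow> 0
      | Alpha1_Alpha2 \<Rightarrow> [:2:] * U * V | Alpha1_2Alpha2 \<Rightarrow> V^2)" for r
    have P: "curve P z = ?q (poly U z) (poly V z)" for z
      unfolding curve_def lincomb_eq_nvec by (simp add: P_def)
    have "?q u v \<in> stratum_closure Orb_a10" for u v
      by (simp add: Z_nvec power2_eq_square algebra_simps)
    then show "\<exists>P. curve P 0 = x \<and> curve P 1 = y \<and> (\<forall>z. curve P z \<in> stratum_closure Orb_a10)"
      by (intro exI[of _ P]) (simp only: P, simp add: x y U_def V_def)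
  qed
qed

lemma joined_stratum_closure:
  assumes "(2 :: 'a::alg_closed_field) \<noteq> 0"
  shows "joined (stratum_closure i :: ('a^5^5) set)"
  using joined_quadric_cone[OF assms] joined_slice
  by (cases i) (simp_all only: stratum_closure.simps Z_coords_eq_slice)

lemma finite_curve_avoids:
  fixes P :: "pos_root \<Rightarrow> 'a::alg_closed_field poly"
  assumes f: "f \<in> poly_fun" and P: "\<And>z. curve P z \<in> K" and w: "f (curve P w) \<noteq> 0"
  shows "finite {z. curve P z \<notin> {x \<in> K. f x \<noteq> 0}}"
proof -
  obtain q where q: "\<And>z. f (curve P z) = poly q z" using poly_fun_curve[OF f] by blast
  then have "q \<noteq> 0" using w by auto
  then show ?thesis using P by (simp add: q poly_roots_finite)
qed

lemma joined_irreducible: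
  fixes K :: "('a::alg_closed_field^5^5) set"
  assumes K: "joined K" and f: "f \<in> poly_fun" and x: "x \<in> K" "f x \<noteq> 0"
  shows "irreducible_in zariski {x \<in> K. f x \<noteq> 0}"
proof (rule irreducible_in_zariskiI)
  fix p q assume p: "p \<in> {x \<in> K. f x \<noteq> 0}" "q \<in> {x \<in> K. f x \<noteq> 0}"
  then obtain P where "curve P 0 = p" "curve P 1 = q" "\<And>z. curve P z \<in> K"
    using K unfolding joined_def by blast
  then show "\<exists>P. curve P 0 = p \<and> curve P 1 = q \<and> finite {z. curve P z \<notin> {x \<in> K. f x \<noteq> 0}}"
    using finite_curve_avoids[OF f, of P K 0] p by auto
qed (use K x in \<open>auto simp: joined_def\<close>)

lemma irreducible_coordinate_subspace:
  "irreducible_in zariski (Z (X ` R) :: ('a::alg_closed_field^5^5) set)"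
proof -
  have "(0 :: 'a^5^5) \<in> slice nilrad 0 R" by (simp add: slice_def root_vec_nvec(1))
  from joined_irreducible[OF joined_slice poly_fun.const[of 1] this]
  show ?thesis by (simp add: Z_coords_eq_slice)
qed

lemma joined_closure:
  fixes K :: "('a::alg_closed_field^5^5) set"
  assumes K: "joined K" and f: "f \<in> poly_fun" and x: "x \<in> K" "f x \<noteq> 0"
  shows "K \<subseteq> zariski closure_of {x \<in> K. f x \<noteq> 0}"
proof
  fix p assume "p \<in> K"
  then obtain P where P: "curve P 0 = p" "curve P 1 = x" "\<And>z. curve P z \<in> K"
    using K x unfolding joined_def by blast
  then have "finite {z. curve P z \<notin> {x \<in> K. f x \<noteq> 0}}"
    using finite_curve_avoids[OF f, of P K 1] x by auto
  then show "p \<in> zariski closure_of {x \<in> K. f x \<noteq> 0}"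
    using closure_of_curve[of P _ 0] P(1) by simp
qed

lemma Delta_poly_fun: "Delta \<in> poly_fun"
proof -
  have "(\<lambda>x. X Alpha1_Alpha2 x * X Alpha1_Alpha2 x + 2 * X Alpha1 x * X Alpha1_2Alpha2 x) \<in> poly_fun"
    by (intro poly_fun.intros)
  then show ?thesis by (simp add: Delta_def[abs_def] power2_eq_square)
qed

lemma nonvanishing_poly_fun: "nonvanishing i \<in> poly_fun"
  using poly_fun.mult[OF poly_fun.coord Delta_poly_fun]
    poly_fun.mult[OF poly_fun.coord poly_fun.coord]
  by (cases i) (simp_all only: nonvanishing.simps poly_fun.const poly_fun.coord)

lemma closedin_stratum_closure: "closedin zariski (stratum_closure i)"
proof -
  have "X ` R \<subseteq> poly_fun" for R using poly_fun.coord by blast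
  then have "closedin zariski (Z (X ` R))" for R by (auto simp: closedin_zariski)
  moreover have "closedin zariski (Z {X Alpha2, Delta})"
    using poly_fun.coord Delta_poly_fun unfolding closedin_zariski
    by (intro exI[of _ "{X Alpha2, Delta}"]) auto
  ultimately show ?thesis by (cases i) (simp_all only: stratum_closure.simps)
qed

text \<open>
  A curve from a point of the closure to the representative stays in the stratum for almost all
  parameters.
\<close>

lemma closure_of_stratum:
  assumes two: "(2 :: 'a::alg_closed_field) \<noteq> 0"
  shows "zariski closure_of stratum i = (stratum_closure i :: ('a^5^5) set)"
proof
  show "zariski closure_of stratum i \<subseteq> (stratum_closure i :: ('a^5^5) set)"
    by (rule closure_of_minimal) (auto simp: stratum_def closedin_stratum_closure)
  show "(stratum_closure i :: ('a^5^5) set) \<subseteq> zariski closure_of stratum i"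
    using joined_closure[OF joined_stratum_closure[OF two] nonvanishing_poly_fun, of "orbit_rep i" i i]
      orbit_rep_in_stratum[OF two, of i] by (simp add: stratum_def)
qed

section \<open>Dimensions of the orbits\<close>

text \<open>
  The coordinates that vanish on the subspace prolong the tower up to the whole nilradical.
\<close>

lemma tower_in_coordinate_subspace:
  fixes C :: "('a::alg_closed_field^5^5) set"
  assumes "tower fs C" "C \<subseteq> Z (X ` R)"
  shows "length fs + card R \<le> 4"
  using finite[of R] assms
proof (induction R arbitrary: fs C rule: finite_induct)
  case empty
  then show ?case using tower_length_le_4 by simp
next
  case (insert r R)
  define e where "e = (lincomb (\<lambda>s. if s = r then 1 else 0) :: 'a^5^5)"
  have e: "X s e = (if s = r then 1 else 0)" for s by (simp add: e_def X_lincomb)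
  have mem: "e \<in> Z (X ` R)" using insert.hyps(2) by (auto simp: Z_def e) (simp add: e_def nilrad_def)
  have "tower (X r # fs) (Z (X ` R) :: ('a^5^5) set)"
  proof (rule tower.step[OF insert.prems(1) _ irreducible_coordinate_subspace poly_fun.coord])
    show "C \<subseteq> Z (X ` R)" and "\<forall>x\<in>C. X r x = 0" using insert.prems(2) by (auto simp: Z_def)
    show "\<exists>x\<in>Z (X ` R). X r (x :: 'a^5^5) \<noteq> 0" using mem e by (intro bexI[of _ e]) simp_all
  qed
  then show ?case using insert.IH[of "X r # fs" "Z (X ` R)"] insert.hyps by simp
qed

fun stratum_dim :: "orbit_index \<Rightarrow> nat" where
  "stratum_dim Orb_0 = 0"
| "stratum_dim Orb_a12 = 1"
| "stratum_dim Orb_a11 = 2"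
| "stratum_dim Orb_a10 = 2"
| "stratum_dim Orb_a01 = 3"
| "stratum_dim Orb_a10_a12 = 3"
| "stratum_dim Orb_a10_a01 = 4"

lemma variety_dim_stratum_le:
  assumes two: "(2 :: 'a::alg_closed_field) \<noteq> 0"
  shows "variety_dim (stratum i :: ('a^5^5) set) \<le> enat (stratum_dim i)"
proof (rule variety_dim_leI)
  fix fs :: "('a^5^5 \<Rightarrow> 'a) list" and C
  assume C: "tower fs C" "C \<subseteq> stratum i"
  then have sub: "C \<subseteq> stratum_closure i" by (auto simp: stratum_def)
  have le: "length fs \<le> 4 - card R" if "stratum_closure i = (Z (X ` R) :: ('a^5^5) set)" for R
    using tower_in_coordinate_subspace[OF C(1), of R] sub that by simp
  show "length fs \<le> stratum_dim i"
  proof (cases i)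
    case Orb_a10
    have "tower (Delta # fs) (Z (X ` {Alpha2}))"
    proof (rule tower.step[OF C(1) _ irreducible_coordinate_subspace Delta_poly_fun])
      show "C \<subseteq> Z (X ` {Alpha2})" and "\<forall>x\<in>C. Delta x = 0"
        using sub Orb_a10 by (auto simp: Z_def)
      show "\<exists>x\<in>Z (X ` {Alpha2}). Delta (x :: 'a^5^5) \<noteq> 0"
        using two by (intro bexI[of _ "nvec 1 0 0 1"]) (simp_all add: Z_nvec)
    qed
    then show ?thesis using tower_in_coordinate_subspace[of "Delta # fs" _ "{Alpha2}"] Orb_a10 by simp
  qed (use le[of "{Alpha1, Alpha2, Alpha1_Alpha2, Alpha1_2Alpha2}"]
      le[of "{Alpha1, Alpha2, Alpha1_Alpha2}"] le[of "{Alpha1, Alpha2}"] le[of "{Alpha1}"]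
      le[of "{Alpha2}"] le[of "{}"] in simp_all)
qed

text \<open>
  The flag in a stratum is obtained by fixing initial segments of this list to the values at the
  representative. On the cone the coordinate \<open>\<alpha>\<^sub>1 + \<alpha>\<^sub>2\<close> comes first: fixing it to \<open>0\<close> also
  forces the coordinate \<open>\<alpha>\<^sub>1 + 2\<alpha>\<^sub>2\<close> to vanish, which leaves a line.
\<close>

fun free_coords :: "orbit_index \<Rightarrow> pos_root list" where
  "free_coords Orb_0 = []"
| "free_coords Orb_a12 = [Alpha1_2Alpha2]"
| "free_coords Orb_a11 = [Alpha1_Alpha2, Alpha1_2Alpha2]"
| "free_coords Orb_a10 = [Alpha1_Alpha2, Alpha1]"
| "free_coords Orb_a01 = [Alpha2, Alpha1_Alpha2, Alpha1_2Alpha2]"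
| "free_coords Orb_a10_a12 = [Alpha1, Alpha1_Alpha2, Alpha1_2Alpha2]"
| "free_coords Orb_a10_a01 = [Alpha1, Alpha2, Alpha1_Alpha2, Alpha1_2Alpha2]"

lemma irreducible_slice_coordinate_subspace:
  assumes two: "(2 :: 'a::alg_closed_field) \<noteq> 0" and "stratum_closure i = (Z (X ` S) :: ('a^5^5) set)"
  shows "irreducible_in zariski (slice (stratum i) (orbit_rep i) R :: ('a^5^5) set)"
proof -
  have orbit_rep: "(orbit_rep i :: 'a^5^5) \<in> stratum i" by (rule orbit_rep_in_stratum[OF two])
  then have "X r (orbit_rep i :: 'a^5^5) = 0" if "r \<in> S" for r
    using that assms(2) by (auto simp: stratum_def Z_def)
  then have eq: "slice (stratum i) (orbit_rep i :: 'a^5^5) R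
      = {x \<in> slice nilrad (orbit_rep i) (S \<union> R). nonvanishing i x \<noteq> 0}"
    unfolding stratum_def assms(2) by (auto simp: slice_def Z_def)
  have "orbit_rep i \<in> slice nilrad (orbit_rep i :: 'a^5^5) (S \<union> R)"
    using orbit_rep stratum_nilrad by (auto simp: slice_def)
  moreover have "nonvanishing i (orbit_rep i :: 'a^5^5) \<noteq> 0" using orbit_rep by (simp add: stratum_def)
  ultimately show ?thesis
    unfolding eq by (rule joined_irreducible[OF joined_slice nonvanishing_poly_fun])
qed

text \<open>
  A slice of the cone by \<open>c = 0\<close> is linear on the stratum: where \<open>a \<noteq> 0\<close>, the equation
  \<open>c\<^sup>2 + 2ad = 0\<close> with \<open>c = 0\<close> gives \<open>d = 0\<close>.
\<close>

lemma irreducible_slice_cone: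
  assumes two: "(2 :: 'a::alg_closed_field) \<noteq> 0"
    and R: "R \<in> {{}, {Alpha1_Alpha2}, {Alpha1_Alpha2, Alpha1}}"
  shows "irreducible_in zariski (slice (stratum Orb_a10) (orbit_rep Orb_a10) R :: ('a^5^5) set)"
proof (cases "R = {}")
  case True
  have "irreducible_in zariski {x \<in> stratum_closure Orb_a10. nonvanishing Orb_a10 (x :: 'a^5^5) \<noteq> 0}"
    using orbit_rep_in_stratum[OF two, of Orb_a10] unfolding stratum_def
    by (intro joined_irreducible[OF joined_stratum_closure[OF two] nonvanishing_poly_fun,
          of "orbit_rep Orb_a10"]) auto
  then show ?thesis by (simp add: True slice_def stratum_def)
next
  case False
  define S where "S = insert Alpha1_2Alpha2 (insert Alpha2 R)"
  have R': "Alpha1_Alpha2 \<in> R" using R False by auto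
  have eq: "slice (stratum Orb_a10) (orbit_rep Orb_a10) R
      = {x \<in> slice nilrad (orbit_rep Orb_a10 :: 'a^5^5) S. X Alpha1 x \<noteq> 0}"
    using R' two by (auto simp: slice_def stratum_def Z_def S_def Delta_def)
  have "orbit_rep Orb_a10 \<in> slice nilrad (orbit_rep Orb_a10 :: 'a^5^5) S" by (simp add: slice_def)
  moreover have "X Alpha1 (orbit_rep Orb_a10 :: 'a^5^5) \<noteq> 0" by simp
  ultimately show ?thesis
    unfolding eq by (rule joined_irreducible[OF joined_slice poly_fun.coord])
qed

lemma variety_dim_stratum_ge:
  assumes two: "(2 :: 'a::alg_closed_field) \<noteq> 0"
  shows "enat (stratum_dim i) \<le> variety_dim (stratum i :: ('a^5^5) set)"
proof -
  have len: "length (free_coords i) = stratum_dim i" by (cases i) simp_all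
  have irr: "irreducible_in zariski
      (slice (stratum i) (orbit_rep i) (set (take k (free_coords i))) :: ('a^5^5) set)"
    for k
  proof (cases "i = Orb_a10")
    case True
    have "set (take k (free_coords Orb_a10)) \<in> {{}, {Alpha1_Alpha2}, {Alpha1_Alpha2, Alpha1}}"
      by (cases k; cases "k - 1") auto
    then show ?thesis using irreducible_slice_cone[OF two] True by blast
  next
    case False
    have "\<exists>S. stratum_closure i = (Z (X ` S) :: ('a^5^5) set)"
      using False by (cases i) (simp_all only: stratum_closure.simps, blast+)
    then show ?thesis using irreducible_slice_coordinate_subspace[OF two] by blast
  qed
  have free: "\<exists>x\<in>slice (stratum i) (orbit_rep i :: 'a^5^5) (set (take k (free_coords i))).
      X (free_coords i ! k) x \<noteq> X (free_coords i ! k) (orbit_rep i)"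
    if "k < length (free_coords i)" for k
  proof -
    \<comment> \<open>As \<open>0, 1, 2\<close> are distinct, \<open>2\<close> serves as a nonzero value other than \<open>1\<close>.\<close>
    have ex: ?thesis if "y \<in> stratum i" "\<forall>r\<in>set (take k (free_coords i)). X r y = X r (orbit_rep i)"
      "X (free_coords i ! k) y \<noteq> X (free_coords i ! k) (orbit_rep i)" for y :: "'a^5^5"
      using that by (auto simp: slice_def)
    have simps: "(2 :: 'a) \<noteq> 1" "(4 :: 'a) \<noteq> 0" "(2 :: 'a) \<noteq> 0"
      using four_neq_0[OF two] two by (metis one_add_one add_cancel_right_right zero_neq_one)+
    show ?thesis
    proof (cases i)
      case Orb_0
      then show ?thesis using that by simp
    next
      case Orb_a12
      then have "k = 0"
        using that by (simp add: less_Suc_eq)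
      then show ?thesis using Orb_a12 simps
        by (intro ex[of "nvec 0 0 0 2"]) (simp_all add: stratum_def Z_nvec)
    next
      case Orb_a11
      then have "k = 0 \<or> k = Suc 0"
        using that by (simp add: less_Suc_eq)
      then show ?thesis
      proof (elim disjE)
        assume "k = 0"
        then show ?thesis using Orb_a11 simps
          by (intro ex[of "nvec 0 0 2 0"]) (simp_all add: stratum_def Z_nvec power2_eq_square)
      next
        assume "k = Suc 0"
        then show ?thesis using Orb_a11 simps
          by (intro ex[of "nvec 0 0 1 1"]) (simp_all add: stratum_def Z_nvec power2_eq_square)
      qed
    next
      case Orb_a10
      then have "k = 0 \<or> k = Suc 0"
        using that by (simp add: less_Suc_eq)
      then show ?thesis
      proof (elim disjE)
        assume "k = 0"
        then show ?thesis using Orb_a10 simps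
          by (intro ex[of "nvec 1 0 2 (-2)"]) (simp_all add: stratum_def Z_nvec power2_eq_square)
      next
        assume "k = Suc 0"
        then show ?thesis using Orb_a10 simps
          by (intro ex[of "nvec 2 0 0 0"]) (simp_all add: stratum_def Z_nvec power2_eq_square)
      qed
    next
      case Orb_a01
      then have "k = 0 \<or> k = Suc 0 \<or> k = Suc (Suc 0)"
        using that by (simp add: less_Suc_eq)
      then show ?thesis
      proof (elim disjE)
        assume "k = 0"
        then show ?thesis using Orb_a01 simps
          by (intro ex[of "nvec 0 2 0 0"]) (simp_all add: stratum_def Z_nvec power2_eq_square)
      next
        assume "k = Suc 0"
        then show ?thesis using Orb_a01 simps
          by (intro ex[of "nvec 0 1 1 0"]) (simp_all add: stratum_def Z_nvec power2_eq_square)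
      next
        assume "k = Suc (Suc 0)"
        then show ?thesis using Orb_a01 simps
          by (intro ex[of "nvec 0 1 0 1"]) (simp_all add: stratum_def Z_nvec power2_eq_square)
      qed
    next
      case Orb_a10_a12
      then have "k = 0 \<or> k = Suc 0 \<or> k = Suc (Suc 0)"
        using that by (simp add: less_Suc_eq)
      then show ?thesis
      proof (elim disjE)
        assume "k = 0"
        then show ?thesis using Orb_a10_a12 simps
          by (intro ex[of "nvec 2 0 0 1"]) (simp_all add: stratum_def Z_nvec power2_eq_square)
      next
        assume "k = Suc 0"
        then show ?thesis using Orb_a10_a12 simps
          by (intro ex[of "nvec 1 0 1 0"]) (simp_all add: stratum_def Z_nvec power2_eq_square)
      next
        assume "k = Suc (Suc 0)"
        then show ?thesis using Orb_a10_a12 simps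
          by (intro ex[of "nvec 1 0 0 2"]) (simp_all add: stratum_def Z_nvec power2_eq_square)
      qed
    next
      case Orb_a10_a01
      then have "k = 0 \<or> k = Suc 0 \<or> k = Suc (Suc 0) \<or> k = Suc (Suc (Suc 0))"
        using that by (simp add: less_Suc_eq)
      then show ?thesis
      proof (elim disjE)
        assume "k = 0"
        then show ?thesis using Orb_a10_a01 simps
          by (intro ex[of "nvec 2 1 0 0"]) (simp_all add: stratum_def Z_nvec power2_eq_square)
      next
        assume "k = Suc 0"
        then show ?thesis using Orb_a10_a01 simps
          by (intro ex[of "nvec 1 2 0 0"]) (simp_all add: stratum_def Z_nvec power2_eq_square)
      next
        assume "k = Suc (Suc 0)"
        then show ?thesis using Orb_a10_a01 simps
          by (intro ex[of "nvec 1 1 1 0"]) (simp_all add: stratum_def Z_nvec power2_eq_square)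
      next
        assume "k = Suc (Suc (Suc 0))"
        then show ?thesis using Orb_a10_a01 simps
          by (intro ex[of "nvec 1 1 0 1"]) (simp_all add: stratum_def Z_nvec power2_eq_square)
      qed
    qed
  qed
  show ?thesis
    using variety_dim_geI[OF stratum_nilrad irr free] len by simp
qed

lemma variety_dim_stratum:
  assumes "(2 :: 'a::alg_closed_field) \<noteq> 0"
  shows "variety_dim (stratum i :: ('a^5^5) set) = enat (stratum_dim i)"
  using variety_dim_stratum_le[OF assms] variety_dim_stratum_ge[OF assms] by (rule antisym)

section \<open>The closure order\<close>

fun orbits_below :: "orbit_index \<Rightarrow> orbit_index set" where
  "orbits_below Orb_0 = {Orb_0}"
| "orbits_below Orb_a12 = {Orb_0, Orb_a12}"
| "orbits_below Orb_a11 = {Orb_0, Orb_a12, Orb_a11}"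
| "orbits_below Orb_a10 = {Orb_0, Orb_a12, Orb_a10}"
| "orbits_below Orb_a01 = {Orb_0, Orb_a12, Orb_a11, Orb_a01}"
| "orbits_below Orb_a10_a12 = {Orb_0, Orb_a12, Orb_a11, Orb_a10, Orb_a10_a12}"
| "orbits_below Orb_a10_a01 = {Orb_0, Orb_a12, Orb_a11, Orb_a10, Orb_a01, Orb_a10_a12, Orb_a10_a01}"

text \<open>
  By the equations of the closures it suffices to test the representatives.
\<close>

lemma stratum_subset_closure_iff:
  assumes two: "(2 :: 'a::alg_closed_field) \<noteq> 0"
  shows "(stratum i :: ('a^5^5) set) \<subseteq> zariski closure_of stratum j \<longleftrightarrow> i \<in> orbits_below j"
  unfolding closure_of_stratum[OF two]
proof
  assume "stratum i \<subseteq> (stratum_closure j :: ('a^5^5) set)"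
  then have "(orbit_rep i :: 'a^5^5) \<in> stratum_closure j" using orbit_rep_in_stratum[OF two] by blast
  then show "i \<in> orbits_below j" using two by (cases i; cases j) (simp_all add: Z_nvec)
next
  assume "i \<in> orbits_below j"
  show "stratum i \<subseteq> (stratum_closure j :: ('a^5^5) set)"
  proof
    fix x :: "'a^5^5" assume x: "x \<in> stratum i"
    then obtain a b c d where "x = nvec a b c d" using stratum_nilrad nilrad_cases by blast
    then show "x \<in> stratum_closure j"
      using x \<open>i \<in> orbits_below j\<close> by (cases i; cases j) (auto simp: stratum_def Z_nvec)
  qed
qed

lemma inj_stratum:
  assumes two: "(2 :: 'a::alg_closed_field) \<noteq> 0"
  shows "inj (stratum :: orbit_index \<Rightarrow> ('a^5^5) set)"
  using orbit_rep_in_stratum[OF two] stratum_disjoint by (metis injI)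

lemma closure_order_strata:
  assumes two: "(2 :: 'a::alg_closed_field) \<noteq> 0"
  shows "closure_order (range (stratum :: orbit_index \<Rightarrow> ('a^5^5) set))
    = map_prod stratum stratum ` {(i, j). i \<in> orbits_below j}"
  unfolding closure_order_def using stratum_subset_closure_iff[OF two] by auto

lemma partial_order_on_map_prod:
  assumes "inj f" "partial_order_on UNIV r"
  shows "partial_order_on (range f) (map_prod f f ` r)"
proof -
  have r: "refl r" "trans r" "antisym r" using partial_order_onD[OF assms(2)] by auto
  have mem: "(f x, f y) \<in> map_prod f f ` r \<longleftrightarrow> (x, y) \<in> r" for x y
    using assms(1) by (auto simp: inj_eq)
  have sub: "map_prod f f ` r \<subseteq> range f \<times> range f" by auto
  have "refl_on (range f) (map_prod f f ` r)"
    using r(1) mem by (auto simp: refl_on_def)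
  moreover have "trans (map_prod f f ` r)"
    using r(2) assms(1) unfolding trans_def by (auto simp: inj_eq)
  moreover have "antisym (map_prod f f ` r)"
    using r(3) assms(1) unfolding antisym_def by (auto simp: inj_eq)
  ultimately show ?thesis using sub by (simp add: partial_order_on_def preorder_on_def)
qed

lemma covering_map_prod:
  assumes "inj f"
  shows "covering (map_prod f f ` r) = map_prod f f ` covering r"
proof -
  have mem: "(f x, f y) \<in> map_prod f f ` r \<longleftrightarrow> (x, y) \<in> r" for x y
    using assms by (auto simp: inj_eq)
  have ex: "(\<exists>z. z \<noteq> f x \<and> z \<noteq> f y \<and> (f x, z) \<in> map_prod f f ` r \<and> (z, f y) \<in> map_prod f f ` r)
      \<longleftrightarrow> (\<exists>z. z \<noteq> x \<and> z \<noteq> y \<and> (x, z) \<in> r \<and> (z, y) \<in> r)" for x y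
  proof
    assume "\<exists>z. z \<noteq> f x \<and> z \<noteq> f y \<and> (f x, z) \<in> map_prod f f ` r \<and> (z, f y) \<in> map_prod f f ` r"
    then obtain z where z: "z \<noteq> f x" "z \<noteq> f y" "(f x, z) \<in> map_prod f f ` r"
        "(z, f y) \<in> map_prod f f ` r"
      by (elim exE conjE) (rule that)
    then obtain w where "z = f w" by auto
    then show "\<exists>z. z \<noteq> x \<and> z \<noteq> y \<and> (x, z) \<in> r \<and> (z, y) \<in> r"
      using z by (intro exI[of _ w]) (simp only: mem inj_eq[OF assms], simp)
  next
    assume "\<exists>z. z \<noteq> x \<and> z \<noteq> y \<and> (x, z) \<in> r \<and> (z, y) \<in> r"
    then show "\<exists>z. z \<noteq> f x \<and> z \<noteq> f y \<and> (f x, z) \<in> map_prod f f ` r \<and> (z, f y) \<in> map_prod f f ` r"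
      using mem inj_eq[OF assms] by metis
  qed
  have "(u, v) \<in> covering (map_prod f f ` r) \<longleftrightarrow> (u, v) \<in> map_prod f f ` covering r" for u v
  proof -
    have "(u, v) \<in> covering (map_prod f f ` r) \<longleftrightarrow>
        (\<exists>x y. u = f x \<and> v = f y \<and> (f x, f y) \<in> covering (map_prod f f ` r))"
      by (auto simp: covering_def)
    also have "\<dots> \<longleftrightarrow> (\<exists>x y. u = f x \<and> v = f y \<and> (x, y) \<in> covering r)"
      by (simp only: covering_def mem_Collect_eq case_prod_conv mem ex inj_eq[OF assms])
    finally show ?thesis by auto
  qed
  then show ?thesis by auto
qed

lemma UNIV_orbit_index: "UNIV = {Orb_0, Orb_a12, Orb_a11, Orb_a10, Orb_a01, Orb_a10_a12, Orb_a10_a01}"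
  using orbit_index.exhaust by auto

lemma partial_order_orbits_below: "partial_order_on UNIV {(i, j). i \<in> orbits_below j}"
proof -
  have "i \<in> orbits_below j \<Longrightarrow> j \<in> orbits_below k \<Longrightarrow> i \<in> orbits_below k" for i j k
    by (cases k; cases j) auto
  moreover have "i \<in> orbits_below j \<Longrightarrow> j \<in> orbits_below i \<Longrightarrow> i = j" for i j
    by (cases i; cases j) auto
  moreover have "i \<in> orbits_below i" for i by (cases i) auto
  ultimately show ?thesis
    unfolding partial_order_on_def preorder_on_def refl_on_def trans_def antisym_def by blast
qed

lemma covering_orbits_below:
  "covering {(i, j). i \<in> orbits_below j} =
    {(Orb_0, Orb_a12), (Orb_a12, Orb_a11), (Orb_a12, Orb_a10), (Orb_a11, Orb_a01),
     (Orb_a11, Orb_a10_a12), (Orb_a10, Orb_a10_a12), (Orb_a01, Orb_a10_a01),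
     (Orb_a10_a12, Orb_a10_a01)}"
  (is "_ = ?H")
proof -
  have "(i, j) \<in> covering {(i, j). i \<in> orbits_below j} \<longleftrightarrow>
      i \<in> orbits_below j \<and> i \<noteq> j \<and> (\<forall>z\<in>orbits_below j. i \<in> orbits_below z \<longrightarrow> z = i \<or> z = j)" for i j
    by (auto simp: covering_def)
  moreover have "(i \<in> orbits_below j \<and> i \<noteq> j \<and> (\<forall>z\<in>orbits_below j. i \<in> orbits_below z \<longrightarrow> z = i \<or> z = j))
      \<longleftrightarrow> (i, j) \<in> ?H" for i j
    by (cases i; cases j; simp)
  ultimately have eq: "p \<in> covering {(i, j). i \<in> orbits_below j} \<longleftrightarrow> p \<in> ?H" for p
    by (cases p) (simp only:)
  show ?thesis by (rule Set.set_eqI) (rule eq)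
qed

theorem theorem3:
  fixes B :: "('a::alg_closed_field^5^5) monoid"
  assumes char: "CHAR('a) \<noteq> 2"
    and B: "B = borel_SO5"
  shows
    "orbits B nilrad Ad =
       {orbit B Ad 0,
        orbit B Ad (root_vec Alpha1_2Alpha2),
        orbit B Ad (root_vec Alpha1_Alpha2),
        orbit B Ad (root_vec Alpha1),
        orbit B Ad (root_vec Alpha2),
        orbit B Ad (root_vec Alpha1 + root_vec Alpha1_2Alpha2),
        orbit B Ad (root_vec Alpha1 + root_vec Alpha2)} \<and>
     card (orbits B nilrad Ad) = 7 \<and>

     orbit B Ad 0 = Z {X Alpha1, X Alpha2, X Alpha1_Alpha2, X Alpha1_2Alpha2} \<and>
     variety_dim (orbit B Ad 0) = 0 \<and>

     orbit B Ad (root_vec Alpha1_2Alpha2) =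
       Z {X Alpha1, X Alpha2, X Alpha1_Alpha2} \<inter> V (X Alpha1_2Alpha2) \<and>
     variety_dim (orbit B Ad (root_vec Alpha1_2Alpha2)) = 1 \<and>

     orbit B Ad (root_vec Alpha1_Alpha2) = Z {X Alpha1, X Alpha2} \<inter> V (X Alpha1_Alpha2) \<and>
     variety_dim (orbit B Ad (root_vec Alpha1_Alpha2)) = 2 \<and>

     orbit B Ad (root_vec Alpha1) =
       Z {X Alpha2, \<lambda>x. (X Alpha1_Alpha2 x)^2 + 2 * X Alpha1 x * X Alpha1_2Alpha2 x}
         \<inter> V (X Alpha1) \<and>
     variety_dim (orbit B Ad (root_vec Alpha1)) = 2 \<and>

     orbit B Ad (root_vec Alpha2) = Z {X Alpha1} \<inter> V (X Alpha2) \<and>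
     variety_dim (orbit B Ad (root_vec Alpha2)) = 3 \<and>

     orbit B Ad (root_vec Alpha1 + root_vec Alpha1_2Alpha2) =
       Z {X Alpha2} \<inter> V (X Alpha1)
         \<inter> V (\<lambda>x. (X Alpha1_Alpha2 x)^2 + 2 * X Alpha1 x * X Alpha1_2Alpha2 x) \<and>
     variety_dim (orbit B Ad (root_vec Alpha1 + root_vec Alpha1_2Alpha2)) = 3 \<and>

     orbit B Ad (root_vec Alpha1 + root_vec Alpha2) = V (X Alpha1) \<inter> V (X Alpha2) \<and>
     variety_dim (orbit B Ad (root_vec Alpha1 + root_vec Alpha2)) = 4 \<and>

     partial_order_on (orbits B nilrad Ad) (closure_order (orbits B nilrad Ad)) \<and>
     covering (closure_order (orbits B nilrad Ad)) =
       {(orbit B Ad 0, orbit B Ad (root_vec Alpha1_2Alpha2)),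
        (orbit B Ad (root_vec Alpha1_2Alpha2), orbit B Ad (root_vec Alpha1_Alpha2)),
        (orbit B Ad (root_vec Alpha1_2Alpha2), orbit B Ad (root_vec Alpha1)),
        (orbit B Ad (root_vec Alpha1_Alpha2), orbit B Ad (root_vec Alpha2)),
        (orbit B Ad (root_vec Alpha1_Alpha2),
         orbit B Ad (root_vec Alpha1 + root_vec Alpha1_2Alpha2)),
        (orbit B Ad (root_vec Alpha1),
         orbit B Ad (root_vec Alpha1 + root_vec Alpha1_2Alpha2)),
        (orbit B Ad (root_vec Alpha2), orbit B Ad (root_vec Alpha1 + root_vec Alpha2)),
        (orbit B Ad (root_vec Alpha1 + root_vec Alpha1_2Alpha2),
         orbit B Ad (root_vec Alpha1 + root_vec Alpha2))}"

proof -
  have two: "(2 :: 'a) \<noteq> 0" using char by (rule two_neq_0)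
  note reps = orbit_rep.simps[where 'a='a, symmetric]
  have orbit: "orbit B Ad 0 = (stratum Orb_0 :: ('a^5^5) set)"
    "orbit B Ad (root_vec Alpha1_2Alpha2) = (stratum Orb_a12 :: ('a^5^5) set)"
    "orbit B Ad (root_vec Alpha1_Alpha2) = (stratum Orb_a11 :: ('a^5^5) set)"
    "orbit B Ad (root_vec Alpha1) = (stratum Orb_a10 :: ('a^5^5) set)"
    "orbit B Ad (root_vec Alpha2) = (stratum Orb_a01 :: ('a^5^5) set)"
    "orbit B Ad (root_vec Alpha1 + root_vec Alpha1_2Alpha2) = (stratum Orb_a10_a12 :: ('a^5^5) set)"
    "orbit B Ad (root_vec Alpha1 + root_vec Alpha2) = (stratum Orb_a10_a01 :: ('a^5^5) set)"
    unfolding B orbit_of_rep[OF two, symmetric] by (simp_all only: root_vec_nvec orbit_rep.simps)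
  have orbits: "orbits B nilrad Ad = range (stratum :: orbit_index \<Rightarrow> ('a^5^5) set)"
    unfolding B by (rule orbits_nilrad[OF two])
  have strata:
    "(stratum Orb_0 :: ('a^5^5) set) = Z {X Alpha1, X Alpha2, X Alpha1_Alpha2, X Alpha1_2Alpha2}"
    "(stratum Orb_a12 :: ('a^5^5) set) = Z {X Alpha1, X Alpha2, X Alpha1_Alpha2} \<inter> V (X Alpha1_2Alpha2)"
    "(stratum Orb_a11 :: ('a^5^5) set) = Z {X Alpha1, X Alpha2} \<inter> V (X Alpha1_Alpha2)"
    "(stratum Orb_a10 :: ('a^5^5) set) =
      Z {X Alpha2, \<lambda>x. (X Alpha1_Alpha2 x)^2 + 2 * X Alpha1 x * X Alpha1_2Alpha2 x} \<inter> V (X Alpha1)"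
    "(stratum Orb_a01 :: ('a^5^5) set) = Z {X Alpha1} \<inter> V (X Alpha2)"
    "(stratum Orb_a10_a12 :: ('a^5^5) set) = Z {X Alpha2} \<inter> V (X Alpha1)
      \<inter> V (\<lambda>x. (X Alpha1_Alpha2 x)^2 + 2 * X Alpha1 x * X Alpha1_2Alpha2 x)"
    "(stratum Orb_a10_a01 :: ('a^5^5) set) = V (X Alpha1) \<inter> V (X Alpha2)"
    unfolding Delta_def[symmetric] by (auto simp: stratum_def Z_def V_def)
  have "card (range (stratum :: orbit_index \<Rightarrow> ('a^5^5) set)) = card (UNIV :: orbit_index set)"
    by (rule card_image[OF inj_stratum[OF two]])
  then have card: "card (range (stratum :: orbit_index \<Rightarrow> ('a^5^5) set)) = 7"
    by (simp add: UNIV_orbit_index)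
  have range: "range (stratum :: orbit_index \<Rightarrow> ('a^5^5) set) =
      {stratum Orb_0, stratum Orb_a12, stratum Orb_a11, stratum Orb_a10,
       stratum Orb_a01, stratum Orb_a10_a12, stratum Orb_a10_a01}"
    by (simp add: UNIV_orbit_index)
  note dim = variety_dim_stratum[OF two]
  have dims:
    "variety_dim (stratum Orb_0 :: ('a^5^5) set) = 0"
    "variety_dim (stratum Orb_a12 :: ('a^5^5) set) = 1"
    "variety_dim (stratum Orb_a11 :: ('a^5^5) set) = 2"
    "variety_dim (stratum Orb_a10 :: ('a^5^5) set) = 2"
    "variety_dim (stratum Orb_a01 :: ('a^5^5) set) = 3"
    "variety_dim (stratum Orb_a10_a12 :: ('a^5^5) set) = 3"
    "variety_dim (stratum Orb_a10_a01 :: ('a^5^5) set) = 4"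
    by (simp_all add: dim enat_0 one_enat_def numeral_eq_enat)
  note order = partial_order_on_map_prod[OF inj_stratum[OF two] partial_order_orbits_below]
  have cover: "covering (closure_order (range (stratum :: orbit_index \<Rightarrow> ('a^5^5) set))) =
      {(stratum Orb_0, stratum Orb_a12), (stratum Orb_a12, stratum Orb_a11),
       (stratum Orb_a12, stratum Orb_a10),
       (stratum Orb_a11, stratum Orb_a01), (stratum Orb_a11, stratum Orb_a10_a12),
       (stratum Orb_a10, stratum Orb_a10_a12),
       (stratum Orb_a01, stratum Orb_a10_a01), (stratum Orb_a10_a12, stratum Orb_a10_a01)}"
    unfolding closure_order_strata[OF two] covering_map_prod[OF inj_stratum[OF two]] covering_orbits_below
    by simp
  show ?thesis
    unfolding orbits orbit
    using range card strata dims cover order unfolding closure_order_strata[OF two]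
    by (intro conjI) assumption+
qed

end
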